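(* Let $\mathbf{C}$ be a pointed category with finite limits. Let $\mathbb{S}$ be the collection of all classes of points in $\mathbf{C}$ and let $\mathbb{T}$ be the collection of all classes of generalized points in $\mathbf{C}$. For a generalized point $(f:A\to B,\ g:C\to A)$, let $(A\times_B C,\pi_1,\pi_2)$ denote the pullback of $f:A\to B$ and $fg:C\to B$, and let $\langle g,1_C\rangle:C\to A\times_B C$ be the induced morphism with $\pi_1\langle g,1_C\rangle=g$ and $\pi_2\langle g,1_C\rangle=1_C$, so that $(\pi_2,\langle g,1_C\rangle)$ is a point. Let $F:\mathbb{T}\to\mathbb{S}$ and $G:\mathbb{S}\to\mathbb{T}$ be the maps defined by $$F(\mathbf{T})=\{(f,g)\in\mathbf{T}\mid (f,g)\text{ is a point}\},\qquad G(\mathbf{S})=\{(f,g)\text{ a generalized point in }\mathbf{C}\mid(\pi_2,\langle g,1_C\rangle)\in\mathbf{S}\}.$$ Then $F$ and $G$ induce mutually inverse bijections between the collection of all $\mathbf{T}\in\mathbb{T}$ such that $\mathbf{C}$ is a $\mathbf{T}$-protomodular category and the collection of all $\mathbf{S}\in\mathbb{S}$ such that $\mathbf{C}$ is an $\mathbf{S}$-protomodular category.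
   Context: $\mathbf{C}$ is a pointed category (it has a zero object) with finite limits. Generalized points. A generalized point in $\mathbf{C}$ is a pair $(f,g)$ of morphisms $f:A\to B$, $g:C\to A$ such that $fg:C\to B$ is a pullback stable regular epimorphism (every pullback of it along any morphism is a regular epimorphism). A morphism $(f,g)\to(f',g')$ of generalized points is a triple $(\alpha:A\to A',\ \beta:B\to B',\ \gamma:C\to C')$ with $\alpha g=g'\gamma$ and $f'\alpha=\beta f$. This gives the category $\mathbf{GPt}(\mathbf{C})$. A point (= split generalized point) is a generalized point $(f,g)$ with $C=B$ and $fg=1_B$; points form the full subcategory $\mathbf{Pt}(\mathbf{C})$, in which finite limits are computed component-wise. Two morphisms $u:U\to A$ and $v:V\to A$ are jointly strongly epic if every monomorphism $m:M\to A$ through which both $u$ and $v$ factor is an isomorphism. A generalized point $(f,g)$ is strong if $g$ and $\ker(f):\mathrm{Ker}(f)\to A$ are jointly strongly epic. The pullback of a generalized point $(f,g)$ along $x:X\to B$ is the generalized point $(\pi_2,g\times 1)$, where $\pi_2:A\times_BX\to X$ is the second projection of the pullback of $f$ and $x$, and $g\times 1:C\times_BX\to A\times_BX$ is induced by $g$, with $C\times_BX$ the pullback of $fg$ and $x$. For a point $(f,s)$ this is, up to isomorphism, the point $(\pi_2,\langle sx,1_X\rangle)$. A class of (generalized) points is pullback stable if it contains all pullbacks of its elements along all morphisms into their codomains $B$. Pullbacks and limits are determined only up to isomorphism, so the closure conditions below include closure under isomorphism. $\mathbf{S}$-protomodularity. For a class $\mathbf{S}$ of points, $\mathbf{C}$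 is $\mathbf{S}$-protomodular if: (a) $\mathbf{S}$ is pullback stable; (b) $\mathbf{S}$ (as a full subcategory) is closed under finite limits in $\mathbf{Pt}(\mathbf{C})$ (including the terminal object); (c) all elements of $\mathbf{S}$ are strong. $\mathbf{T}$-protomodularity. For a class $\mathbf{T}$ of generalized points, $\mathbf{C}$ is $\mathbf{T}$-protomodular if: (a) $\mathbf{T}$ is pullback stable; (b) $\mathbf{T}$ (as a full subcategory) is closed under component-wise finite limits in $\mathbf{GPt}(\mathbf{C})$, that is, whenever the component-wise limit (computed in the category of all composable pairs of morphisms of $\mathbf{C}$) of a finite diagram of elements of $\mathbf{T}$ is a generalized point, it belongs to $\mathbf{T}$; (c) all elements of $\mathbf{T}$ are strong; (d) for every generalized point $(f:A\to B,g:C\to A)$, with $(A\times_BC,\pi_1,\pi_2)$ the pullback of $f$ and $fg$, one has $(\pi_2,\langle g,1_C\rangle)\in\mathbf{T}$ if and only if $(f,g)\in\mathbf{T}$. *)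

theory Defs
  imports Main
begin

section \<open>Categories, functors and limits\<close>

record ('o, 'm) cat =
  Obj :: "'o set"
  Arr :: "'m set"
  Dom :: "'m \<Rightarrow> 'o"
  Cod :: "'m \<Rightarrow> 'o"
  Id :: "'o \<Rightarrow> 'm"
  Comp :: "'m \<Rightarrow> 'm \<Rightarrow> 'm"  (infixl "\<cdot>\<index>" 70)

text \<open>Composition is written in the usual order: \<open>f \<cdot> g\<close> is \<open>g\<close> followed by \<open>f\<close>.\<close>

definition hom :: "('o, 'm) cat \<Rightarrow> 'o \<Rightarrow> 'o \<Rightarrow> 'm set" where
  "hom C a b = {f \<in> Arr C. Dom C f = a \<and> Cod C f = b}"

locale category =
  fixes C :: "('o, 'm) cat" (structure)
  assumes dom_obj: "f \<in> Arr C \<Longrightarrow> Dom C f \<in> Obj C"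
    and cod_obj: "f \<in> Arr C \<Longrightarrow> Cod C f \<in> Obj C"
    and id_hom: "a \<in> Obj C \<Longrightarrow> Id C a \<in> hom C a a"
    and comp_hom: "\<lbrakk>g \<in> hom C a b; f \<in> hom C b c\<rbrakk> \<Longrightarrow> f \<cdot> g \<in> hom C a c"
    and id_left: "f \<in> hom C a b \<Longrightarrow> Id C b \<cdot> f = f"
    and id_right: "f \<in> hom C a b \<Longrightarrow> f \<cdot> Id C a = f"
    and comp_assoc: "\<lbrakk>h \<in> hom C a b; g \<in> hom C b c; f \<in> hom C c d\<rbrakk>
      \<Longrightarrow> (f \<cdot> g) \<cdot> h = f \<cdot> (g \<cdot> h)"

text \<open>A functor (or diagram) is given by its object part \<open>D\<close> and its arrow part \<open>d\<close>.\<close>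

definition is_functor :: "('j, 'k) cat \<Rightarrow> ('o, 'm) cat \<Rightarrow> ('j \<Rightarrow> 'o) \<Rightarrow> ('k \<Rightarrow> 'm) \<Rightarrow> bool" where
  "is_functor J C D d \<longleftrightarrow>
     (\<forall>i \<in> Obj J. D i \<in> Obj C) \<and>
     (\<forall>u \<in> Arr J. d u \<in> hom C (D (Dom J u)) (D (Cod J u))) \<and>
     (\<forall>i \<in> Obj J. d (Id J i) = Id C (D i)) \<and>
     (\<forall>u \<in> Arr J. \<forall>v \<in> Arr J. Dom J v = Cod J u \<longrightarrow> d (v \<cdot>\<^bsub>J\<^esub> u) = d v \<cdot>\<^bsub>C\<^esub> d u)"

definition is_cone ::
  "('j, 'k) cat \<Rightarrow> ('o, 'm) cat \<Rightarrow> ('j \<Rightarrow> 'o) \<Rightarrow> ('k \<Rightarrow> 'm) \<Rightarrow> 'o \<Rightarrow> ('j \<Rightarrow> 'm) \<Rightarrow> bool" where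
  "is_cone J C D d L p \<longleftrightarrow>
     L \<in> Obj C \<and>
     (\<forall>i \<in> Obj J. p i \<in> hom C L (D i)) \<and>
     (\<forall>u \<in> Arr J. d u \<cdot>\<^bsub>C\<^esub> p (Dom J u) = p (Cod J u))"

definition is_limit ::
  "('j, 'k) cat \<Rightarrow> ('o, 'm) cat \<Rightarrow> ('j \<Rightarrow> 'o) \<Rightarrow> ('k \<Rightarrow> 'm) \<Rightarrow> 'o \<Rightarrow> ('j \<Rightarrow> 'm) \<Rightarrow> bool" where
  "is_limit J C D d L p \<longleftrightarrow>
     is_cone J C D d L p \<and>
     (\<forall>L' p'. is_cone J C D d L' p' \<longrightarrow>
        (\<exists>!h. h \<in> hom C L' L \<and> (\<forall>i \<in> Obj J. p i \<cdot>\<^bsub>C\<^esub> h = p' i)))"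

text \<open>Every finite category is isomorphic to one whose objects and arrows are natural numbers,
  so these suffice as shapes of finite diagrams.\<close>

definition finite_category :: "(nat, nat) cat \<Rightarrow> bool" where
  "finite_category J \<longleftrightarrow> category J \<and> finite (Obj J) \<and> finite (Arr J)"

definition has_finite_limits :: "('o, 'm) cat \<Rightarrow> bool" where
  "has_finite_limits C \<longleftrightarrow>
     (\<forall>J D d. finite_category J \<and> is_functor J C D d \<longrightarrow> (\<exists>L p. is_limit J C D d L p))"

definition full_subcategory :: "('o, 'm) cat \<Rightarrow> 'o set \<Rightarrow> ('o, 'm) cat" where
  "full_subcategory C P =
     C\<lparr>Obj := Obj C \<inter> P, Arr := {f \<in> Arr C. Dom C f \<in> P \<and> Cod C f \<in> P}\<rparr>"


section \<open>Special objects and arrows\<close>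

definition is_zero_object :: "('o, 'm) cat \<Rightarrow> 'o \<Rightarrow> bool" where
  "is_zero_object C Z \<longleftrightarrow>
     Z \<in> Obj C \<and> (\<forall>a \<in> Obj C. (\<exists>!f. f \<in> hom C a Z) \<and> (\<exists>!f. f \<in> hom C Z a))"

definition pointed :: "('o, 'm) cat \<Rightarrow> bool" where
  "pointed C \<longleftrightarrow> (\<exists>Z. is_zero_object C Z)"

definition is_zero_arrow :: "('o, 'm) cat \<Rightarrow> 'm \<Rightarrow> bool" where
  "is_zero_arrow C f \<longleftrightarrow> f \<in> Arr C \<and>
     (\<exists>Z. is_zero_object C Z \<and>
        (\<exists>u \<in> hom C (Dom C f) Z. \<exists>v \<in> hom C Z (Cod C f). f = v \<cdot>\<^bsub>C\<^esub> u))"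

definition is_kernel :: "('o, 'm) cat \<Rightarrow> 'm \<Rightarrow> 'm \<Rightarrow> bool" where
  "is_kernel C f k \<longleftrightarrow>
     f \<in> Arr C \<and> k \<in> Arr C \<and> Cod C k = Dom C f \<and> is_zero_arrow C (f \<cdot>\<^bsub>C\<^esub> k) \<and>
     (\<forall>h \<in> Arr C. Cod C h = Dom C f \<and> is_zero_arrow C (f \<cdot>\<^bsub>C\<^esub> h) \<longrightarrow>
        (\<exists>!t. t \<in> hom C (Dom C h) (Dom C k) \<and> k \<cdot>\<^bsub>C\<^esub> t = h))"

definition is_mono :: "('o, 'm) cat \<Rightarrow> 'm \<Rightarrow> bool" where
  "is_mono C m \<longleftrightarrow> m \<in> Arr C \<and>
     (\<forall>X. \<forall>u \<in> hom C X (Dom C m). \<forall>v \<in> hom C X (Dom C m). m \<cdot>\<^bsub>C\<^esub> u = m \<cdot>\<^bsub>C\<^esub> v \<longrightarrow> u = v)"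

definition is_iso :: "('o, 'm) cat \<Rightarrow> 'm \<Rightarrow> bool" where
  "is_iso C m \<longleftrightarrow> m \<in> Arr C \<and>
     (\<exists>n \<in> hom C (Cod C m) (Dom C m).
        n \<cdot>\<^bsub>C\<^esub> m = Id C (Dom C m) \<and> m \<cdot>\<^bsub>C\<^esub> n = Id C (Cod C m))"

definition is_coequalizer :: "('o, 'm) cat \<Rightarrow> 'm \<Rightarrow> 'm \<Rightarrow> 'm \<Rightarrow> bool" where
  "is_coequalizer C u v q \<longleftrightarrow>
     u \<in> Arr C \<and> v \<in> Arr C \<and> q \<in> Arr C \<and>
     Dom C u = Dom C v \<and> Cod C u = Dom C q \<and> Cod C v = Dom C q \<and>
     q \<cdot>\<^bsub>C\<^esub> u = q \<cdot>\<^bsub>C\<^esub> v \<and>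
     (\<forall>h \<in> Arr C. Dom C h = Dom C q \<and> h \<cdot>\<^bsub>C\<^esub> u = h \<cdot>\<^bsub>C\<^esub> v \<longrightarrow>
        (\<exists>!t. t \<in> hom C (Cod C q) (Cod C h) \<and> t \<cdot>\<^bsub>C\<^esub> q = h))"

definition regular_epi :: "('o, 'm) cat \<Rightarrow> 'm \<Rightarrow> bool" where
  "regular_epi C q \<longleftrightarrow> (\<exists>u v. is_coequalizer C u v q)"

text \<open>\<open>is_pullback C f x p1 p2\<close>: the pullback of \<open>f : A \<rightarrow> B\<close> and \<open>x : X \<rightarrow> B\<close> has projections
  \<open>p1 : P \<rightarrow> A\<close> and \<open>p2 : P \<rightarrow> X\<close>; its vertex \<open>P\<close> is recovered as \<open>Dom C p1\<close>.\<close>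

definition is_pullback :: "('o, 'm) cat \<Rightarrow> 'm \<Rightarrow> 'm \<Rightarrow> 'm \<Rightarrow> 'm \<Rightarrow> bool" where
  "is_pullback C f x p1 p2 \<longleftrightarrow>
     f \<in> Arr C \<and> x \<in> Arr C \<and> p1 \<in> Arr C \<and> p2 \<in> Arr C \<and>
     Cod C f = Cod C x \<and> Dom C p1 = Dom C p2 \<and> Cod C p1 = Dom C f \<and> Cod C p2 = Dom C x \<and>
     f \<cdot>\<^bsub>C\<^esub> p1 = x \<cdot>\<^bsub>C\<^esub> p2 \<and>
     (\<forall>q1 \<in> Arr C. \<forall>q2 \<in> Arr C.
        Dom C q1 = Dom C q2 \<and> Cod C q1 = Dom C f \<and> Cod C q2 = Dom C x \<and>
        f \<cdot>\<^bsub>C\<^esub> q1 = x \<cdot>\<^bsub>C\<^esub> q2 \<longrightarrow>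
        (\<exists>!h. h \<in> hom C (Dom C q1) (Dom C p1) \<and> p1 \<cdot>\<^bsub>C\<^esub> h = q1 \<and> p2 \<cdot>\<^bsub>C\<^esub> h = q2))"

definition pullback_stable_regular_epi :: "('o, 'm) cat \<Rightarrow> 'm \<Rightarrow> bool" where
  "pullback_stable_regular_epi C q \<longleftrightarrow> regular_epi C q \<and>
     (\<forall>x p1 p2. is_pullback C q x p1 p2 \<longrightarrow> regular_epi C p2)"

definition jointly_strongly_epic :: "('o, 'm) cat \<Rightarrow> 'm \<Rightarrow> 'm \<Rightarrow> bool" where
  "jointly_strongly_epic C u v \<longleftrightarrow>
     u \<in> Arr C \<and> v \<in> Arr C \<and> Cod C u = Cod C v \<and>
     (\<forall>m. is_mono C m \<and> Cod C m = Cod C u \<and>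
        (\<exists>u' \<in> hom C (Dom C u) (Dom C m). m \<cdot>\<^bsub>C\<^esub> u' = u) \<and>
        (\<exists>v' \<in> hom C (Dom C v) (Dom C m). m \<cdot>\<^bsub>C\<^esub> v' = v) \<longrightarrow>
        is_iso C m)"


section \<open>Generalized points\<close>

definition is_gen_point :: "('o, 'm) cat \<Rightarrow> 'm \<Rightarrow> 'm \<Rightarrow> bool" where
  "is_gen_point C f g \<longleftrightarrow>
     f \<in> Arr C \<and> g \<in> Arr C \<and> Cod C g = Dom C f \<and> pullback_stable_regular_epi C (f \<cdot>\<^bsub>C\<^esub> g)"

definition is_point :: "('o, 'm) cat \<Rightarrow> 'm \<Rightarrow> 'm \<Rightarrow> bool" where
  "is_point C f g \<longleftrightarrow>
     is_gen_point C f g \<and> Dom C g = Cod C f \<and> f \<cdot>\<^bsub>C\<^esub> g = Id C (Cod C f)"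

text \<open>In the category of composable pairs, an arrow from \<open>(f, g)\<close> to \<open>(f', g')\<close> is a triple
  \<open>(\<alpha>, \<beta>, \<gamma>)\<close>; it is stored together with its domain and codomain.\<close>

type_synonym 'm pair_arrow = "('m \<times> 'm) \<times> ('m \<times> 'm \<times> 'm) \<times> ('m \<times> 'm)"

definition composable_pairs :: "('o, 'm) cat \<Rightarrow> ('m \<times> 'm, 'm pair_arrow) cat" where
  "composable_pairs C =
     (let pairs = {(f, g). f \<in> Arr C \<and> g \<in> Arr C \<and> Cod C g = Dom C f} in
      \<lparr>Obj = pairs,
       Arr = {((f, g), (\<alpha>, \<beta>, \<gamma>), (f', g')) | f g \<alpha> \<beta> \<gamma> f' g'.
          (f, g) \<in> pairs \<and> (f', g') \<in> pairs \<and>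
          \<alpha> \<in> hom C (Dom C f) (Dom C f') \<and>
          \<beta> \<in> hom C (Cod C f) (Cod C f') \<and>
          \<gamma> \<in> hom C (Dom C g) (Dom C g') \<and>
          \<alpha> \<cdot>\<^bsub>C\<^esub> g = g' \<cdot>\<^bsub>C\<^esub> \<gamma> \<and> f' \<cdot>\<^bsub>C\<^esub> \<alpha> = \<beta> \<cdot>\<^bsub>C\<^esub> f},
       Dom = (\<lambda>(P, t, Q). P),
       Cod = (\<lambda>(P, t, Q). Q),
       Id = (\<lambda>(f, g). ((f, g), (Id C (Dom C f), Id C (Cod C f), Id C (Dom C g)), (f, g))),
       Comp = (\<lambda>(Q', (\<alpha>', \<beta>', \<gamma>'), R) (P, (\<alpha>, \<beta>, \<gamma>), Q).
          (P, (\<alpha>' \<cdot>\<^bsub>C\<^esub> \<alpha>, \<beta>' \<cdot>\<^bsub>C\<^esub> \<beta>, \<gamma>' \<cdot>\<^bsub>C\<^esub> \<gamma>), R))\<rparr>)"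

definition GPt :: "('o, 'm) cat \<Rightarrow> ('m \<times> 'm, 'm pair_arrow) cat" where
  "GPt C = full_subcategory (composable_pairs C) {(f, g). is_gen_point C f g}"

definition Pt :: "('o, 'm) cat \<Rightarrow> ('m \<times> 'm, 'm pair_arrow) cat" where
  "Pt C = full_subcategory (GPt C) {(f, g). is_point C f g}"

text \<open>A cone in the category of composable pairs is a component-wise limit if each of its three
  components (at \<open>A\<close>, \<open>B\<close> and the domain of \<open>g\<close>) is a limit cone in \<open>C\<close>.\<close>

definition componentwise_limit ::
  "('j, 'k) cat \<Rightarrow> ('o, 'm) cat \<Rightarrow> ('j \<Rightarrow> 'm \<times> 'm) \<Rightarrow> ('k \<Rightarrow> 'm pair_arrow) \<Rightarrow>
   'm \<times> 'm \<Rightarrow> ('j \<Rightarrow> 'm pair_arrow) \<Rightarrow> bool" where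
  "componentwise_limit J C D d L p \<longleftrightarrow>
     is_cone J (composable_pairs C) D d L p \<and>
     (let objA = (\<lambda>(f, g). Dom C f); objB = (\<lambda>(f, g). Cod C f); objC = (\<lambda>(f, g). Dom C g);
          arrA = (\<lambda>(P, (\<alpha>, \<beta>, \<gamma>), Q). \<alpha>); arrB = (\<lambda>(P, (\<alpha>, \<beta>, \<gamma>), Q). \<beta>);
          arrC = (\<lambda>(P, (\<alpha>, \<beta>, \<gamma>), Q). \<gamma>)
      in is_limit J C (objA \<circ> D) (arrA \<circ> d) (objA L) (arrA \<circ> p) \<and>
         is_limit J C (objB \<circ> D) (arrB \<circ> d) (objB L) (arrB \<circ> p) \<and>
         is_limit J C (objC \<circ> D) (arrC \<circ> d) (objC L) (arrC \<circ> p))"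

definition strong_gen_point :: "('o, 'm) cat \<Rightarrow> 'm \<Rightarrow> 'm \<Rightarrow> bool" where
  "strong_gen_point C f g \<longleftrightarrow>
     is_gen_point C f g \<and> (\<exists>k. is_kernel C f k \<and> jointly_strongly_epic C g k)"

text \<open>\<open>is_section_point C f g p h\<close>: the point \<open>(p, h)\<close> is \<open>(\<pi>\<^sub>2, \<langle>g, 1\<rangle>)\<close> for some choice of the
  pullback \<open>(\<pi>\<^sub>1, \<pi>\<^sub>2)\<close> of \<open>f\<close> and \<open>f \<cdot> g\<close>.\<close>

definition is_section_point :: "('o, 'm) cat \<Rightarrow> 'm \<Rightarrow> 'm \<Rightarrow> 'm \<Rightarrow> 'm \<Rightarrow> bool" where
  "is_section_point C f g p h \<longleftrightarrow>
     (\<exists>p1. is_pullback C f (f \<cdot>\<^bsub>C\<^esub> g) p1 p \<and>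
        h \<in> hom C (Dom C g) (Dom C p1) \<and> p1 \<cdot>\<^bsub>C\<^esub> h = g \<and> p \<cdot>\<^bsub>C\<^esub> h = Id C (Dom C g))"


section \<open>Protomodularity relative to a class of (generalized) points\<close>

text \<open>All closure conditions quantify over every choice of the pullback or limit involved, and
  hence include closure under isomorphism.\<close>

definition pt_pullback_stable :: "('o, 'm) cat \<Rightarrow> ('m \<times> 'm) set \<Rightarrow> bool" where
  "pt_pullback_stable C S \<longleftrightarrow>
     (\<forall>f s x p1 p2 h. (f, s) \<in> S \<and> is_pullback C f x p1 p2 \<and>
        h \<in> hom C (Dom C x) (Dom C p1) \<and> p1 \<cdot>\<^bsub>C\<^esub> h = s \<cdot>\<^bsub>C\<^esub> x \<and> p2 \<cdot>\<^bsub>C\<^esub> h = Id C (Dom C x) \<longrightarrow>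
        (p2, h) \<in> S)"

definition gpt_pullback_stable :: "('o, 'm) cat \<Rightarrow> ('m \<times> 'm) set \<Rightarrow> bool" where
  "gpt_pullback_stable C T \<longleftrightarrow>
     (\<forall>f g x p1 p2 c1 c2 h. (f, g) \<in> T \<and>
        is_pullback C f x p1 p2 \<and> is_pullback C (f \<cdot>\<^bsub>C\<^esub> g) x c1 c2 \<and>
        h \<in> hom C (Dom C c1) (Dom C p1) \<and> p1 \<cdot>\<^bsub>C\<^esub> h = g \<cdot>\<^bsub>C\<^esub> c1 \<and> p2 \<cdot>\<^bsub>C\<^esub> h = c2 \<longrightarrow>
        (p2, h) \<in> T)"

definition closed_under_finite_limits_in_Pt :: "('o, 'm) cat \<Rightarrow> ('m \<times> 'm) set \<Rightarrow> bool" where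
  "closed_under_finite_limits_in_Pt C S \<longleftrightarrow>
     (\<forall>J D d L p. finite_category J \<and> is_functor J (Pt C) D d \<and> (\<forall>i \<in> Obj J. D i \<in> S) \<and>
        is_limit J (Pt C) D d L p \<longrightarrow> L \<in> S)"

definition closed_under_componentwise_finite_limits ::
  "('o, 'm) cat \<Rightarrow> ('m \<times> 'm) set \<Rightarrow> bool" where
  "closed_under_componentwise_finite_limits C T \<longleftrightarrow>
     (\<forall>J D d L p. finite_category J \<and> is_functor J (GPt C) D d \<and> (\<forall>i \<in> Obj J. D i \<in> T) \<and>
        componentwise_limit J C D d L p \<and> L \<in> Obj (GPt C) \<longrightarrow> L \<in> T)"

definition S_protomodular :: "('o, 'm) cat \<Rightarrow> ('m \<times> 'm) set \<Rightarrow> bool" where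
  "S_protomodular C S \<longleftrightarrow>
     S \<subseteq> Obj (Pt C) \<and>
     pt_pullback_stable C S \<and>
     closed_under_finite_limits_in_Pt C S \<and>
     (\<forall>(f, s) \<in> S. strong_gen_point C f s)"

definition T_protomodular :: "('o, 'm) cat \<Rightarrow> ('m \<times> 'm) set \<Rightarrow> bool" where
  "T_protomodular C T \<longleftrightarrow>
     T \<subseteq> Obj (GPt C) \<and>
     gpt_pullback_stable C T \<and>
     closed_under_componentwise_finite_limits C T \<and>
     (\<forall>(f, g) \<in> T. strong_gen_point C f g) \<and>
     (\<forall>f g p h. is_gen_point C f g \<and> is_section_point C f g p h \<longrightarrow>
        ((p, h) \<in> T \<longleftrightarrow> (f, g) \<in> T))"

definition point_classes :: "('o, 'm) cat \<Rightarrow> ('m \<times> 'm) set set" where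
  "point_classes C = Pow (Obj (Pt C))"

definition gen_point_classes :: "('o, 'm) cat \<Rightarrow> ('m \<times> 'm) set set" where
  "gen_point_classes C = Pow (Obj (GPt C))"

definition F_map :: "('o, 'm) cat \<Rightarrow> ('m \<times> 'm) set \<Rightarrow> ('m \<times> 'm) set" where
  "F_map C T = {(f, g) \<in> T. is_point C f g}"

text \<open>If \<open>S\<close> is closed under isomorphism of points, the choice of the pullback is immaterial here.\<close>

definition G_map :: "('o, 'm) cat \<Rightarrow> ('m \<times> 'm) set \<Rightarrow> ('m \<times> 'm) set" where
  "G_map C S =
     {(f, g). is_gen_point C f g \<and> (\<exists>p h. is_section_point C f g p h \<and> (p, h) \<in> S)}"

end

theory Submission
  imports Defs
begin

text \<open>A class \<open>T\<close> is recovered from its points because condition (d) decides membership of \<open>(f, g)\<close> by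
  the section point \<open>(\<pi>\<^sub>2, \<langle>g, 1\<rangle>)\<close>, and a point is its own section point, which gives the other
  composite. That \<open>G(S)\<close> inherits the closure properties of \<open>S\<close> rests on the fact that forming section
  points commutes with pullbacks and with component-wise limits. Strongness of \<open>(f, g)\<close> follows from that of
  its section point because \<open>\<pi>\<^sub>1\<close> identifies the kernels of \<open>\<pi>\<^sub>2\<close> and \<open>f\<close> and is a regular epimorphism,
  being a pullback of \<open>f \<cdot> g\<close>. Conversely, \<open>F(T)\<close> is closed under limits because limits of points are
  component-wise.\<close>

text \<open>The two closure conditions under limits are not parallel: for points it speaks of limits
  in the category \<open>Pt C\<close>, for generalized points of component-wise limits whose vertex
  happens to be a generalized point. Pullback stable regular epimorphisms need not be preserved by
  limits, whereas the equation of a split pair passes to them. A morphism of points also has equal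
  components at \<open>B\<close> and \<open>C\<close>, so one limit serves for both. Hence a
  component-wise limit of points exists and is a point, and every limit in \<open>Pt C\<close> is
  isomorphic to it.

  For the passage to section points, the vertex of the pullback of \<open>f\<close> and
  \<open>f \<cdot> g\<close> is treated through its generalized elements: pairs
  \<open>(a, c)\<close> with \<open>f a = f g c\<close>. A compatible family of such pairs over a
  diagram is a pair for the limit. The components \<open>A\<close> and \<open>C\<close> supply
  \<open>a\<close> and \<open>c\<close>, and the component \<open>B\<close> supplies the equation
  between them.

  Independence of the chosen pullbacks is not proved separately: pullback along an identity is a
  case of pullback stability, and it already replaces one choice by another.\<close>

lemma in_hom: "f \<in> hom C a b \<longleftrightarrow> f \<in> Arr C \<and> Dom C f = a \<and> Cod C f = b"
  by (simp add: hom_def)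

section \<open>Typing rules and associativity\<close>

context category
begin

lemma comp_arr [simp]:
  assumes "f \<in> Arr C" "g \<in> Arr C" "Cod C g = Dom C f"
  shows "f \<cdot> g \<in> Arr C" "Dom C (f \<cdot> g) = Dom C g" "Cod C (f \<cdot> g) = Cod C f"
  using comp_hom[of g "Dom C g" "Cod C g" f "Cod C f"] assms by (auto simp: in_hom)

lemma id_arr [simp]:
  assumes "a \<in> Obj C"
  shows "Id C a \<in> Arr C" "Dom C (Id C a) = a" "Cod C (Id C a) = a"
  using id_hom[OF assms] by (auto simp: in_hom)

lemma comp_id [simp]:
  assumes "f \<in> Arr C"
  shows "Cod C f = a \<Longrightarrow> Id C a \<cdot> f = f" "Dom C f = a \<Longrightarrow> f \<cdot> Id C a = f"
  using id_left[of f] id_right[of f] assms by (auto simp: in_hom)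

lemma assoc:
  assumes "f \<in> Arr C" "g \<in> Arr C" "h \<in> Arr C" "Cod C h = Dom C g" "Cod C g = Dom C f"
  shows "(f \<cdot> g) \<cdot> h = f \<cdot> (g \<cdot> h)"
  using comp_assoc[of h "Dom C h" "Cod C h" g "Cod C g" f "Cod C f"] assms by (auto simp: in_hom)

text \<open>Precomposing a commutative square with \<open>h\<close>, with brackets to the right.
  Simplification with \<open>assoc\<close> would hide the left-hand side of the square, so this step
  is kept as a rule.\<close>

lemma comp_eq_comp:
  assumes "f \<cdot> g = x \<cdot> y" "f \<in> Arr C" "g \<in> Arr C" "x \<in> Arr C" "y \<in> Arr C" "h \<in> Arr C"
    and "Cod C g = Dom C f" "Cod C y = Dom C x" "Cod C h = Dom C g" "Cod C h = Dom C y"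
  shows "f \<cdot> (g \<cdot> h) = x \<cdot> (y \<cdot> h)"
  using assms assoc[of f g h] assoc[of x y h] by simp

lemma hom_obj:
  assumes "f \<in> hom C a b"
  shows "a \<in> Obj C" "b \<in> Obj C"
  using assms dom_obj[of f] cod_obj[of f] by (auto simp: in_hom)

declare dom_obj [simp] cod_obj [simp]

section \<open>Pullbacks\<close>

lemma pullbackD:
  assumes "is_pullback C f x p1 p2"
  shows "f \<in> Arr C" "x \<in> Arr C" "p1 \<in> Arr C" "p2 \<in> Arr C" "Cod C x = Cod C f"
    "Dom C p2 = Dom C p1" "Cod C p1 = Dom C f" "Cod C p2 = Dom C x" "f \<cdot> p1 = x \<cdot> p2"
  using assms by (auto simp: is_pullback_def)

lemma pullback_lift:
  assumes "is_pullback C f x p1 p2"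
    and "q1 \<in> hom C Q (Dom C f)" "q2 \<in> hom C Q (Dom C x)" "f \<cdot> q1 = x \<cdot> q2"
  obtains h where "h \<in> hom C Q (Dom C p1)" "p1 \<cdot> h = q1" "p2 \<cdot> h = q2"
  using assms unfolding is_pullback_def in_hom by (metis (full_types))

lemma pullback_unique:
  assumes pb: "is_pullback C f x p1 p2"
    and h: "h \<in> hom C Q (Dom C p1)" and k: "k \<in> hom C Q (Dom C p1)"
    and eq: "p1 \<cdot> h = p1 \<cdot> k" "p2 \<cdot> h = p2 \<cdot> k"
  shows "h = k"
proof -
  note D = pullbackD[OF pb]
  have "f \<cdot> (p1 \<cdot> h) = x \<cdot> (p2 \<cdot> h)"
    using D h by (simp add: in_hom flip: assoc)
  moreover have "p1 \<cdot> h \<in> Arr C" "p2 \<cdot> h \<in> Arr C" "Dom C (p1 \<cdot> h) = Q" "Dom C (p2 \<cdot> h) = Q"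
    "Cod C (p1 \<cdot> h) = Dom C f" "Cod C (p2 \<cdot> h) = Dom C x"
    using D h by (simp_all add: in_hom)
  ultimately have "\<exists>!t. t \<in> hom C Q (Dom C p1) \<and> p1 \<cdot> t = p1 \<cdot> h \<and> p2 \<cdot> t = p2 \<cdot> h"
    using pb unfolding is_pullback_def by metis
  with h k eq show ?thesis by metis
qed

text \<open>Separates the unique existence in the definition into existence of lifts and joint
  monicity of the projections, matching \<open>pullback_lift\<close> and
  \<open>pullback_unique\<close>.\<close>

lemma pullbackI:
  assumes "f \<in> Arr C" "x \<in> Arr C" "p1 \<in> Arr C" "p2 \<in> Arr C" "Cod C x = Cod C f"
    "Dom C p2 = Dom C p1" "Cod C p1 = Dom C f" "Cod C p2 = Dom C x" "f \<cdot> p1 = x \<cdot> p2"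
    and ex: "\<And>Q q1 q2. \<lbrakk>q1 \<in> hom C Q (Dom C f); q2 \<in> hom C Q (Dom C x); f \<cdot> q1 = x \<cdot> q2\<rbrakk>
      \<Longrightarrow> \<exists>h \<in> hom C Q (Dom C p1). p1 \<cdot> h = q1 \<and> p2 \<cdot> h = q2"
    and un: "\<And>Q h k. \<lbrakk>h \<in> hom C Q (Dom C p1); k \<in> hom C Q (Dom C p1); p1 \<cdot> h = p1 \<cdot> k; p2 \<cdot> h = p2 \<cdot> k\<rbrakk>
      \<Longrightarrow> h = k"
  shows "is_pullback C f x p1 p2"
  unfolding is_pullback_def
proof (intro conjI ballI impI)
  fix q1 q2 assume q: "q1 \<in> Arr C" "q2 \<in> Arr C"
    "Dom C q1 = Dom C q2 \<and> Cod C q1 = Dom C f \<and> Cod C q2 = Dom C x \<and> f \<cdot> q1 = x \<cdot> q2"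
  then obtain h where "h \<in> hom C (Dom C q1) (Dom C p1)" "p1 \<cdot> h = q1" "p2 \<cdot> h = q2"
    using ex[of q1 "Dom C q1" q2] by (auto simp: in_hom)
  then show "\<exists>!h. h \<in> hom C (Dom C q1) (Dom C p1) \<and> p1 \<cdot> h = q1 \<and> p2 \<cdot> h = q2"
    using un by metis
qed (use assms in auto)

lemma pullback_sym:
  assumes "is_pullback C f x p1 p2"
  shows "is_pullback C x f p2 p1"
  using assms unfolding is_pullback_def by metis

text \<open>Pasting law: a cone over the outer rectangle is lifted first through the square over
  \<open>x\<close>, then through the square over \<open>y\<close>. Uniqueness descends in the same
  order.\<close>

lemma pullback_paste:
  assumes P: "is_pullback C f x p1 p2" and Q: "is_pullback C p2 y q1 q2"
  shows "is_pullback C f (x \<cdot> y) (p1 \<cdot> q1) q2"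
proof (rule pullbackI)
  note D = pullbackD[OF P] pullbackD[OF Q]
  have "f \<cdot> (p1 \<cdot> q1) = x \<cdot> (p2 \<cdot> q1)" using D by - (rule comp_eq_comp, auto)
  then show "f \<cdot> (p1 \<cdot> q1) = x \<cdot> y \<cdot> q2" using D by (simp add: assoc)
  fix T
  {
    fix t1 t2 assume t: "t1 \<in> hom C T (Dom C f)" "t2 \<in> hom C T (Dom C (x \<cdot> y))" "f \<cdot> t1 = x \<cdot> y \<cdot> t2"
    then have "f \<cdot> t1 = x \<cdot> (y \<cdot> t2)" "y \<cdot> t2 \<in> hom C T (Dom C x)"
      using D by (auto simp: in_hom assoc)
    then obtain h where h: "h \<in> hom C T (Dom C p1)" "p1 \<cdot> h = t1" "p2 \<cdot> h = y \<cdot> t2"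
      using pullback_lift[OF P t(1)] by blast
    then obtain k where "k \<in> hom C T (Dom C q1)" "q1 \<cdot> k = h" "q2 \<cdot> k = t2"
      using pullback_lift[OF Q, of h T t2] t D by (auto simp: in_hom)
    then show "\<exists>h \<in> hom C T (Dom C (p1 \<cdot> q1)). p1 \<cdot> q1 \<cdot> h = t1 \<and> q2 \<cdot> h = t2"
      using D h by (auto simp: in_hom assoc)
  next
    fix h k assume hk: "h \<in> hom C T (Dom C (p1 \<cdot> q1))" "k \<in> hom C T (Dom C (p1 \<cdot> q1))"
      "p1 \<cdot> q1 \<cdot> h = p1 \<cdot> q1 \<cdot> k" "q2 \<cdot> h = q2 \<cdot> k"
    have "p2 \<cdot> (q1 \<cdot> t) = y \<cdot> (q2 \<cdot> t)" if "t \<in> hom C T (Dom C (p1 \<cdot> q1))" for t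
      using D that by (simp add: in_hom flip: assoc)
    then have "q1 \<cdot> h = q1 \<cdot> k"
      using hk D by - (rule pullback_unique[OF P, of _ T], auto simp: in_hom assoc)
    then show "h = k"
      using hk D by - (rule pullback_unique[OF Q, of _ T], auto simp: in_hom)
  }
qed (use pullbackD[OF P] pullbackD[OF Q] in auto)

text \<open>Converse of pasting: a cone \<open>(t1, t2)\<close> over the left square becomes the
  cone \<open>(p1 \<cdot> t1, t2)\<close> over the rectangle. The resulting lift satisfies
  \<open>q1 \<cdot> h = t1\<close> because \<open>p1\<close> and \<open>p2\<close> are jointly
  monic.\<close>

lemma pullback_cancel:
  assumes P: "is_pullback C f x p1 p2" and R: "is_pullback C f (x \<cdot> y) r q2"
    and y: "y \<in> Arr C" "Cod C y = Dom C x"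
    and q1: "q1 \<in> hom C (Dom C r) (Dom C p1)" "p1 \<cdot> q1 = r" "p2 \<cdot> q1 = y \<cdot> q2"
  shows "is_pullback C p2 y q1 q2"
proof (rule pullbackI)
  note D = pullbackD[OF P] pullbackD[OF R] y
  fix T
  {
    fix t1 t2 assume t: "t1 \<in> hom C T (Dom C p2)" "t2 \<in> hom C T (Dom C y)" "p2 \<cdot> t1 = y \<cdot> t2"
    have "f \<cdot> (p1 \<cdot> t1) = x \<cdot> (p2 \<cdot> t1)" using D t by - (rule comp_eq_comp, auto simp: in_hom)
    then have "f \<cdot> (p1 \<cdot> t1) = x \<cdot> y \<cdot> t2" using D t by (simp add: in_hom assoc)
    then obtain h where h: "h \<in> hom C T (Dom C r)" "r \<cdot> h = p1 \<cdot> t1" "q2 \<cdot> h = t2"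
      using pullback_lift[OF R, of "p1 \<cdot> t1" T t2] t D by (auto simp: in_hom)
    have "q1 \<cdot> h = t1"
    proof (rule pullback_unique[OF P, of _ T])
      have "p1 \<cdot> (q1 \<cdot> h) = p1 \<cdot> q1 \<cdot> h" using D h(1) q1(1) by (simp add: in_hom assoc)
      also have "\<dots> = p1 \<cdot> t1" using q1(2) h(2) by simp
      finally show "p1 \<cdot> (q1 \<cdot> h) = p1 \<cdot> t1" .
      have "p2 \<cdot> (q1 \<cdot> h) = p2 \<cdot> q1 \<cdot> h" using D h(1) q1(1) by (simp add: in_hom assoc)
      also have "\<dots> = y \<cdot> (q2 \<cdot> h)" using D h(1) q1(3) by (simp add: in_hom assoc)
      also have "\<dots> = p2 \<cdot> t1" using h(3) t(3) by simp
      finally show "p2 \<cdot> (q1 \<cdot> h) = p2 \<cdot> t1" .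
    qed (use h(1) q1(1) t(1) D in \<open>auto simp: in_hom\<close>)
    then show "\<exists>h \<in> hom C T (Dom C q1). q1 \<cdot> h = t1 \<and> q2 \<cdot> h = t2"
      using h q1 by (auto simp: in_hom)
  next
    fix h k assume hk: "h \<in> hom C T (Dom C q1)" "k \<in> hom C T (Dom C q1)"
      "q1 \<cdot> h = q1 \<cdot> k" "q2 \<cdot> h = q2 \<cdot> k"
    have "r \<cdot> t = p1 \<cdot> (q1 \<cdot> t)" if "t \<in> hom C T (Dom C q1)" for t
      using q1 D(3) that assoc[of p1 q1 t] by (simp add: in_hom)
    then have "r \<cdot> h = r \<cdot> k"
      using hk(1-3) by metis
    then show "h = k"
      using hk D q1 by - (rule pullback_unique[OF R, of _ T], auto simp: in_hom)
  }
qed (use pullbackD[OF P] pullbackD[OF R] y q1 in \<open>auto simp: in_hom\<close>)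

text \<open>The equation for \<open>x\<close> is a hypothesis so that the rule also applies to
  \<open>x = f \<cdot> s\<close> when \<open>(f, s)\<close> is a point.\<close>

lemma pullback_id:
  assumes "f \<in> Arr C" "x = Id C (Cod C f)"
  shows "is_pullback C f x (Id C (Dom C f)) f"
  by (rule pullbackI) (use assms in \<open>auto simp: in_hom\<close>)

text \<open>Finite limits are given only for functors from categories coded on natural numbers, so
  the cospan has to be coded as such a category.\<close>

lemma pullback_exists:
  assumes lim: "has_finite_limits C"
    and f: "f \<in> Arr C" and x: "x \<in> Arr C" and fx: "Cod C x = Cod C f"
  obtains p1 p2 where "is_pullback C f x p1 p2"
proof -
  \<comment> \<open>The cospan: objects 0, 1, 2 with arrows 3 from 0 to 2 and 4 from 1 to 2.\<close>
  define dm :: "nat \<Rightarrow> nat" where "dm u = (if u = 3 then 0 else if u = 4 then 1 else u)" for u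
  define cd :: "nat \<Rightarrow> nat" where "cd u = (if u = 3 \<or> u = 4 then 2 else u)" for u
  \<comment> \<open>Each object number also names its identity. In a composable pair one factor is
    an identity; the outer factor \<open>v\<close> is one exactly when \<open>v = cd u\<close>, and
    otherwise \<open>u\<close> is.\<close>
  define J :: "(nat, nat) cat" where
    "J = \<lparr>Obj = {0, 1, 2}, Arr = {0, 1, 2, 3, 4}, Dom = dm, Cod = cd, Id = id,
      Comp = (\<lambda>v u. if v = cd u then u else v)\<rparr>"
  define D where "D i = (if i = (0::nat) then Dom C f else if i = 1 then Dom C x else Cod C f)" for i
  define d where "d u = (if u = (3::nat) then f else if u = 4 then x else Id C (D u))" for u
  have "finite_category J"
    unfolding finite_category_def category_def J_def dm_def cd_def by (auto simp: in_hom)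
  moreover have "is_functor J C D d"
    using f x fx unfolding is_functor_def J_def D_def d_def dm_def cd_def by (auto simp: in_hom)
  ultimately obtain L p where L: "is_limit J C D d L p"
    using lim unfolding has_finite_limits_def by blast
  then have cone: "is_cone J C D d L p"
    by (simp add: is_limit_def)
  have p: "p 0 \<in> hom C L (Dom C f)" "p 1 \<in> hom C L (Dom C x)" "p 2 = f \<cdot> p 0" "p 2 = x \<cdot> p 1"
    using cone unfolding is_cone_def J_def D_def d_def dm_def cd_def by auto
  \<comment> \<open>A cone over the cospan is determined by its legs at 0 and 1, the leg at 2 being
    \<open>f \<cdot> q1\<close>. This turns the property of the limit into that of the
    pullback.\<close>
  have med: "\<exists>!h. h \<in> hom C Q L \<and> p 0 \<cdot> h = q1 \<and> p 1 \<cdot> h = q2"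
    if q: "q1 \<in> hom C Q (Dom C f)" "q2 \<in> hom C Q (Dom C x)" "f \<cdot> q1 = x \<cdot> q2" for Q q1 q2
  proof -
    define q where "q i = (if i = (0::nat) then q1 else if i = 1 then q2 else f \<cdot> q1)" for i
    have "is_cone J C D d Q q"
      using q f x fx hom_obj(1)[OF q(1)]
      unfolding is_cone_def J_def D_def d_def dm_def cd_def q_def by (auto simp: in_hom)
    then have "\<exists>!h. h \<in> hom C Q L \<and> (\<forall>i \<in> Obj J. p i \<cdot> h = q i)"
      using L by (simp add: is_limit_def)
    moreover have "(\<forall>i \<in> Obj J. p i \<cdot> h = q i) \<longleftrightarrow> p 0 \<cdot> h = q1 \<and> p 1 \<cdot> h = q2"
      if "h \<in> hom C Q L" for h
      using that p f x unfolding J_def q_def by (auto simp: in_hom assoc)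
    ultimately show ?thesis by (metis (no_types, lifting))
  qed
  have L0: "Dom C (p 0) = L"
    using p(1) by (simp add: in_hom)
  have "is_pullback C f x (p 0) (p 1)"
  proof (rule pullbackI, unfold L0)
    show "f \<cdot> p 0 = x \<cdot> p 1" using p(3) unfolding p(4) by (rule sym)
    fix Q
    {
      fix q1 q2 assume "q1 \<in> hom C Q (Dom C f)" "q2 \<in> hom C Q (Dom C x)" "f \<cdot> q1 = x \<cdot> q2"
      from med[OF this] show "\<exists>h \<in> hom C Q L. p 0 \<cdot> h = q1 \<and> p 1 \<cdot> h = q2"
        by (elim ex1E) blast
    next
      fix h k assume hk: "h \<in> hom C Q L" "k \<in> hom C Q L"
        "p 0 \<cdot> h = p 0 \<cdot> k" "p 1 \<cdot> h = p 1 \<cdot> k"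
      have "f \<cdot> (p 0 \<cdot> k) = x \<cdot> (p 1 \<cdot> k)"
        using p hk(2) f x fx by - (rule comp_eq_comp, auto simp: in_hom)
      then have "\<exists>!h. h \<in> hom C Q L \<and> p 0 \<cdot> h = p 0 \<cdot> k \<and> p 1 \<cdot> h = p 1 \<cdot> k"
        using comp_hom[OF hk(2) p(1)] comp_hom[OF hk(2) p(2)] by (intro med)
      then show "h = k"
        using hk by (elim ex1E) metis
    }
  qed (use f x fx p in \<open>auto simp: in_hom\<close>)
  then show thesis by (rule that)
qed

section \<open>Regular epimorphisms and strong pairs\<close>

text \<open>An invertible arrow is the coequalizer of two copies of the identity on its
  domain.\<close>

lemma regular_epi_iso:
  assumes q: "q \<in> Arr C" and n: "n \<in> hom C (Cod C q) (Dom C q)"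
    and nq: "n \<cdot> q = Id C (Dom C q)" and qn: "q \<cdot> n = Id C (Cod C q)"
  shows "regular_epi C q"
proof -
  have "\<exists>!t. t \<in> hom C (Cod C q) (Cod C h) \<and> t \<cdot> q = h" if h: "h \<in> Arr C" "Dom C h = Dom C q" for h
  proof (rule ex1I[of _ "h \<cdot> n"])
    have "h \<cdot> n \<cdot> q = h"
      using assoc[of h n q] h q n nq by (simp add: in_hom)
    then show "h \<cdot> n \<in> hom C (Cod C q) (Cod C h) \<and> h \<cdot> n \<cdot> q = h"
      using h n by (simp add: in_hom)
    fix t assume "t \<in> hom C (Cod C q) (Cod C h) \<and> t \<cdot> q = h"
    then show "t = h \<cdot> n"
      using assoc[of t q n] q n qn by (auto simp: in_hom)
  qed
  then have "is_coequalizer C (Id C (Dom C q)) (Id C (Dom C q)) q"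
    unfolding is_coequalizer_def using q by simp
  then show ?thesis
    unfolding regular_epi_def by blast
qed

text \<open>A pullback of an identity is invertible: the lift \<open>n\<close> of \<open>x\<close>
  and the identity is inverse to \<open>p2\<close>.\<close>

lemma regular_epi_id_pullback:
  assumes "is_pullback C (Id C b) x p1 p2" and b: "b \<in> Obj C"
  shows "regular_epi C p2"
proof -
  note D = pullbackD[OF assms(1)]
  have x: "x \<in> hom C (Dom C x) (Dom C (Id C b))" "Id C (Dom C x) \<in> hom C (Dom C x) (Dom C x)"
    "Id C b \<cdot> x = x \<cdot> Id C (Dom C x)"
    using D b by (auto simp: in_hom)
  obtain n where n: "n \<in> hom C (Dom C x) (Dom C p1)" "p2 \<cdot> n = Id C (Dom C x)" "p1 \<cdot> n = x"
    using pullback_lift[OF assms(1) x] by blast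
  have "n \<cdot> p2 = Id C (Dom C p2)"
  proof (rule pullback_unique[OF assms(1), of _ "Dom C p2"])
    have "p1 \<cdot> (n \<cdot> p2) = x \<cdot> p2"
      using n D(3,4,6,8) assoc[of p1 n p2] by (simp add: in_hom)
    also have "\<dots> = p1"
      using D(9)[symmetric] D(3,7) b by simp
    finally show "p1 \<cdot> (n \<cdot> p2) = p1 \<cdot> Id C (Dom C p2)"
      using D(3,6) by simp
    show "p2 \<cdot> (n \<cdot> p2) = p2 \<cdot> Id C (Dom C p2)"
      using n D(3,4,6,8) assoc[of p2 n p2] by (simp add: in_hom)
  qed (use n(1) D(3,4,6,8) in \<open>auto simp: in_hom\<close>)
  then show ?thesis
    using n D by (intro regular_epi_iso[of p2 n]) auto
qed

lemma pullback_stable_regular_epi_id: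
  assumes "b \<in> Obj C"
  shows "pullback_stable_regular_epi C (Id C b)"
proof -
  have "is_pullback C (Id C b) (Id C b) (Id C b) (Id C b)"
    using pullback_id[of "Id C b" "Id C b"] assms by simp
  then show ?thesis
    unfolding pullback_stable_regular_epi_def using regular_epi_id_pullback assms by blast
qed

text \<open>By pasting, every pullback of \<open>c2\<close> is a pullback of \<open>q\<close> along
  a composite.\<close>

lemma pullback_stable_regular_epi_pullback:
  assumes "pullback_stable_regular_epi C q" "is_pullback C q x c1 c2"
  shows "pullback_stable_regular_epi C c2"
  using assms pullback_paste[OF assms(2)] unfolding pullback_stable_regular_epi_def by blast

text \<open>Since \<open>m\<close> is monic, the factor \<open>n\<close> identifies the same pair as
  \<open>q\<close>, hence descends along \<open>q\<close> to some \<open>t\<close>. This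
  \<open>t\<close> is a section of \<open>m\<close>, and a monomorphism with a section is
  invertible.\<close>

lemma regular_epi_factor_mono_iso:
  assumes q: "regular_epi C q" and m: "is_mono C m"
    and n: "n \<in> hom C (Dom C q) (Dom C m)" "m \<cdot> n = q"
  shows "is_iso C m"
proof -
  obtain u v where co: "is_coequalizer C u v q"
    using q unfolding regular_epi_def by blast
  then have uv: "u \<in> hom C (Dom C u) (Dom C q)" "v \<in> hom C (Dom C u) (Dom C q)" "q \<in> Arr C"
    "q \<cdot> u = q \<cdot> v"
    unfolding is_coequalizer_def by (auto simp: in_hom)
  have un: "\<exists>!t. t \<in> hom C (Cod C q) (Cod C h) \<and> t \<cdot> q = h"
    if "h \<in> Arr C" "Dom C h = Dom C q" "h \<cdot> u = h \<cdot> v" for h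
    using co that unfolding is_coequalizer_def by blast
  have marr: "m \<in> Arr C" "Cod C m = Cod C q"
    using m n by (auto simp: is_mono_def in_hom)
  have "m \<cdot> (n \<cdot> u) = m \<cdot> (n \<cdot> v)"
    using uv n marr by (auto simp: in_hom simp flip: assoc)
  then have "n \<cdot> u = n \<cdot> v"
    using m uv n unfolding is_mono_def by (auto simp: in_hom)
  then obtain t where t: "t \<in> hom C (Cod C q) (Dom C m)" "t \<cdot> q = n"
    using un[of n] n by (auto simp: in_hom)
  have "m \<cdot> t \<cdot> q = m \<cdot> (t \<cdot> q)"
    using t marr uv by (auto simp: in_hom assoc)
  then have "m \<cdot> t \<cdot> q = q"
    using t n by simp
  moreover have "m \<cdot> t \<in> hom C (Cod C q) (Cod C q)" "Id C (Cod C m) \<in> hom C (Cod C q) (Cod C q)"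
    "Id C (Cod C m) \<cdot> q = q"
    using t marr uv by (auto simp: in_hom)
  ultimately have mt: "m \<cdot> t = Id C (Cod C m)"
    using un[of q] uv by blast
  have "m \<cdot> (t \<cdot> m) = m \<cdot> Id C (Dom C m)"
    using t marr mt by (auto simp: in_hom simp flip: assoc)
  then have "t \<cdot> m = Id C (Dom C m)"
    using m t marr unfolding is_mono_def by (auto simp: in_hom)
  with mt t marr show ?thesis
    unfolding is_iso_def by auto
qed

lemma mono_pullback:
  assumes pb: "is_pullback C m x p1 p2" and m: "is_mono C m"
  shows "is_mono C p2"
  unfolding is_mono_def
proof (intro conjI allI ballI impI)
  note D = pullbackD[OF pb]
  fix X u v assume uv: "u \<in> hom C X (Dom C p2)" "v \<in> hom C X (Dom C p2)" "p2 \<cdot> u = p2 \<cdot> v"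
  have "m \<cdot> (p1 \<cdot> t) = x \<cdot> (p2 \<cdot> t)" if "t \<in> hom C X (Dom C p2)" for t
    using that D by (simp add: in_hom flip: assoc)
  then have "m \<cdot> (p1 \<cdot> u) = m \<cdot> (p1 \<cdot> v)"
    using uv by simp
  then have "p1 \<cdot> u = p1 \<cdot> v"
    using m uv D unfolding is_mono_def by (auto simp: in_hom)
  then show "u = v"
    using uv D by - (rule pullback_unique[OF pb, of _ X], auto)
qed (use pullbackD[OF pb] in auto)

section \<open>Zero arrows and kernels\<close>

lemma zero_objectD:
  assumes "is_zero_object C Z" "a \<in> Obj C"
  shows "\<exists>!f. f \<in> hom C a Z" "\<exists>!f. f \<in> hom C Z a"
  using assms by (simp_all add: is_zero_object_def)

lemma zero_arrowE:
  assumes "is_zero_arrow C f" "Dom C f = a" "Cod C f = b"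
  obtains Z u v where "is_zero_object C Z" "u \<in> hom C a Z" "v \<in> hom C Z b" "f = v \<cdot> u"
  using assms unfolding is_zero_arrow_def by blast

lemma zero_arrowI:
  assumes "is_zero_object C Z" "u \<in> hom C a Z" "v \<in> hom C Z b"
  shows "is_zero_arrow C (v \<cdot> u)"
proof -
  have "Dom C (v \<cdot> u) = a" "Cod C (v \<cdot> u) = b" "v \<cdot> u \<in> Arr C"
    using comp_hom[OF assms(2,3)] by (simp_all add: in_hom)
  then show ?thesis
    unfolding is_zero_arrow_def using assms by blast
qed

lemma zero_arrow_comp:
  assumes z: "is_zero_arrow C f" and g: "g \<in> hom C (Cod C f) b"
  shows "is_zero_arrow C (g \<cdot> f)"
proof -
  obtain Z u v where Z: "is_zero_object C Z" "u \<in> hom C (Dom C f) Z"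
    "v \<in> hom C Z (Cod C f)" and f: "f = v \<cdot> u"
    by (rule zero_arrowE[OF z refl refl])
  have "is_zero_arrow C (g \<cdot> v \<cdot> u)"
    using zero_arrowI[OF Z(1,2)] comp_hom[OF Z(3) g] .
  then show ?thesis
    using comp_assoc[OF Z(2,3) g] f by simp
qed

lemma zero_arrow_precomp:
  assumes z: "is_zero_arrow C f" and g: "g \<in> hom C a (Dom C f)"
  shows "is_zero_arrow C (f \<cdot> g)"
proof -
  obtain Z u v where Z: "is_zero_object C Z" "u \<in> hom C (Dom C f) Z"
    "v \<in> hom C Z (Cod C f)" and f: "f = v \<cdot> u"
    by (rule zero_arrowE[OF z refl refl])
  have "is_zero_arrow C (v \<cdot> (u \<cdot> g))"
    using zero_arrowI[OF Z(1) comp_hom[OF g Z(2)] Z(3)] .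
  then show ?thesis
    using comp_assoc[OF g Z(2,3)] f by simp
qed

text \<open>The two arrows may factor through different zero objects \<open>Z\<close> and
  \<open>W\<close>. With the comparison \<open>w\<close> from \<open>Z\<close> to \<open>W\<close>,
  both equal \<open>v' \<cdot> w \<cdot> u\<close>.\<close>

lemma zero_arrow_unique:
  assumes f: "is_zero_arrow C f" and g: "is_zero_arrow C g"
    and eq: "Dom C g = Dom C f" "Cod C g = Cod C f"
  shows "f = g"
proof -
  obtain Z u v where Z: "is_zero_object C Z" "u \<in> hom C (Dom C f) Z"
    "v \<in> hom C Z (Cod C f)" "f = v \<cdot> u"
    by (rule zero_arrowE[OF f refl refl])
  obtain W u' v' where W: "is_zero_object C W" "u' \<in> hom C (Dom C f) W"
    "v' \<in> hom C W (Cod C f)" "g = v' \<cdot> u'"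
    by (rule zero_arrowE[OF g eq])
  obtain w where w: "w \<in> hom C Z W"
    using zero_objectD(1)[OF W(1) hom_obj(2)[OF Z(2)]] by (elim ex1E) blast
  have "\<exists>!t. t \<in> hom C (Dom C f) W"
    by (rule zero_objectD(1)[OF W(1) hom_obj(1)[OF W(2)]])
  then have u': "u' = w \<cdot> u"
    using W(2) comp_hom[OF Z(2) w] by (elim ex1E) metis
  have "\<exists>!t. t \<in> hom C Z (Cod C f)"
    by (rule zero_objectD(2)[OF Z(1) hom_obj(2)[OF W(3)]])
  then have v: "v = v' \<cdot> w"
    using Z(3) comp_hom[OF w W(3)] by (elim ex1E) metis
  have "v \<cdot> u = v' \<cdot> u'"
    unfolding u' v by (rule comp_assoc[OF Z(2) w W(3)])
  with Z(4) W(4) show ?thesis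
    by (metis (mono_tags))
qed

lemma zero_arrow_exists:
  assumes "pointed C" "a \<in> Obj C" "b \<in> Obj C"
  obtains z where "z \<in> hom C a b" "is_zero_arrow C z"
proof -
  obtain Z where Z: "is_zero_object C Z"
    using assms(1) unfolding pointed_def by blast
  obtain u where "u \<in> hom C a Z"
    using zero_objectD(1)[OF Z assms(2)] by (elim ex1E) blast
  moreover obtain v where "v \<in> hom C Z b"
    using zero_objectD(2)[OF Z assms(3)] by (elim ex1E) blast
  ultimately have "v \<cdot> u \<in> hom C a b" "is_zero_arrow C (v \<cdot> u)"
    using comp_hom zero_arrowI[OF Z] by blast+
  then show thesis by (rule that)
qed

text \<open>An arrow \<open>h\<close> killed by \<open>f\<close> pairs with a zero arrow into the
  domain of \<open>x\<close>; the resulting arrow into the pullback is killed by \<open>p2\<close>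
  and therefore factors through \<open>k\<close>.\<close>

lemma kernel_pullback:
  assumes pt: "pointed C" and pb: "is_pullback C f x p1 p2" and k: "is_kernel C p2 k"
  shows "is_kernel C f (p1 \<cdot> k)"
proof -
  note D = pullbackD[OF pb]
  have K: "k \<in> Arr C" "Cod C k = Dom C p2" "is_zero_arrow C (p2 \<cdot> k)"
    and un: "\<And>h. \<lbrakk>h \<in> Arr C; Cod C h = Dom C p2; is_zero_arrow C (p2 \<cdot> h)\<rbrakk>
      \<Longrightarrow> \<exists>!t. t \<in> hom C (Dom C h) (Dom C k) \<and> k \<cdot> t = h"
    using k unfolding is_kernel_def by auto
  have "f \<cdot> (p1 \<cdot> k) = x \<cdot> (p2 \<cdot> k)"
    using D K by - (rule comp_eq_comp, auto)
  then have z: "is_zero_arrow C (f \<cdot> (p1 \<cdot> k))"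
    using zero_arrow_comp[OF K(3), of x] D K by (auto simp: in_hom)
  have "\<exists>!t. t \<in> hom C (Dom C h) (Dom C k) \<and> p1 \<cdot> k \<cdot> t = h"
    if h: "h \<in> Arr C" "Cod C h = Dom C f" "is_zero_arrow C (f \<cdot> h)" for h
  proof -
    obtain o' where o': "o' \<in> hom C (Dom C h) (Dom C x)" "is_zero_arrow C o'"
      using zero_arrow_exists[OF pt, of "Dom C h" "Dom C x"] h D by auto
    have "is_zero_arrow C (x \<cdot> o')"
      using zero_arrow_comp[OF o'(2), of x] o' D by (auto simp: in_hom)
    then have "f \<cdot> h = x \<cdot> o'"
      using zero_arrow_unique[OF h(3)] h o' D by (auto simp: in_hom)
    then obtain l where l: "l \<in> hom C (Dom C h) (Dom C p1)" "p1 \<cdot> l = h" "p2 \<cdot> l = o'"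
      using pullback_lift[OF pb, of h "Dom C h" o'] h o' by (auto simp: in_hom)
    \<comment> \<open>Factorizations of \<open>h\<close> through \<open>p1 \<cdot> k\<close> and of
      \<open>l\<close> through \<open>k\<close> coincide, because
      \<open>p2 \<cdot> (k \<cdot> t)\<close> is forced to be the zero arrow \<open>o'\<close>.
      Uniqueness is inherited this way.\<close>
    have eq: "p1 \<cdot> k \<cdot> t = h \<longleftrightarrow> k \<cdot> t = l" if t: "t \<in> hom C (Dom C h) (Dom C k)" for t
    proof
      assume a: "p1 \<cdot> k \<cdot> t = h"
      have kt: "k \<cdot> t \<in> hom C (Dom C h) (Dom C p1)" using t K D by (auto simp: in_hom)
      have "p2 \<cdot> (k \<cdot> t) = o'"
      proof (rule zero_arrow_unique)
        show "is_zero_arrow C (p2 \<cdot> (k \<cdot> t))"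
          using zero_arrow_precomp[OF K(3), of t "Dom C h"] assoc[of p2 k t] t K D by (simp add: in_hom)
      qed (use o' kt D in \<open>auto simp: in_hom\<close>)
      moreover have "p1 \<cdot> (k \<cdot> t) = p1 \<cdot> l"
        using a t K D(3,6) l(2) assoc[of p1 k t] by (simp add: in_hom)
      ultimately show "k \<cdot> t = l"
        using pullback_unique[OF pb kt l(1)] l(3) by simp
    next
      assume "k \<cdot> t = l"
      then show "p1 \<cdot> k \<cdot> t = h" using l t K D by (auto simp: in_hom assoc)
    qed
    have "\<exists>!t. t \<in> hom C (Dom C l) (Dom C k) \<and> k \<cdot> t = l"
      using un[of l] l o' D by (auto simp: in_hom)
    moreover have "Dom C l = Dom C h" using l by (simp add: in_hom)
    ultimately show ?thesis using eq by metis
  qed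
  then show ?thesis
    unfolding is_kernel_def using z K D by auto
qed

section \<open>Points and generalized points\<close>

lemma gen_pointD:
  assumes "is_gen_point C f g"
  shows "f \<in> Arr C" "g \<in> Arr C" "Cod C g = Dom C f" "pullback_stable_regular_epi C (f \<cdot> g)"
  using assms by (auto simp: is_gen_point_def)

text \<open>The regular epimorphism condition is automatic for a split pair, as its composite is an
  identity.\<close>

lemma is_point_iff:
  "is_point C f s \<longleftrightarrow> f \<in> Arr C \<and> s \<in> Arr C \<and> Cod C s = Dom C f \<and> Dom C s = Cod C f \<and>
    f \<cdot> s = Id C (Cod C f)"
  unfolding is_point_def is_gen_point_def
  using pullback_stable_regular_epi_id[of "Cod C f"] by auto

lemma Obj_GPt: "Obj (GPt C) = {(f, g). is_gen_point C f g}"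
  by (auto simp: GPt_def full_subcategory_def composable_pairs_def is_gen_point_def)

lemma Obj_Pt: "Obj (Pt C) = {(f, g). is_point C f g}"
  using Obj_GPt by (auto simp: Pt_def full_subcategory_def is_point_def)

text \<open>The composite \<open>p2 \<cdot> h\<close> is \<open>c2\<close>, a pullback of
  \<open>f \<cdot> g\<close>.\<close>

lemma gen_point_pullback:
  assumes "is_gen_point C f g" "is_pullback C f x p1 p2" "is_pullback C (f \<cdot> g) x c1 c2"
    and "h \<in> hom C (Dom C c1) (Dom C p1)" "p2 \<cdot> h = c2"
  shows "is_gen_point C p2 h"
  using pullback_stable_regular_epi_pullback[OF gen_pointD(4)[OF assms(1)] assms(3)]
    pullbackD[OF assms(2)] assms(4,5)
  by (simp add: is_gen_point_def in_hom)

section \<open>Section points\<close>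

lemma section_pointE:
  assumes "is_section_point C f g p h"
  obtains p1 where "is_pullback C f (f \<cdot> g) p1 p" "h \<in> hom C (Dom C g) (Dom C p1)"
    "p1 \<cdot> h = g" "p \<cdot> h = Id C (Dom C g)"
  using assms unfolding is_section_point_def by blast

lemma section_point_is_point:
  assumes sec: "is_section_point C f g p h" and "f \<in> Arr C" "g \<in> Arr C" "Cod C g = Dom C f"
  shows "is_point C p h"
proof -
  obtain p1 where s: "is_pullback C f (f \<cdot> g) p1 p" "h \<in> hom C (Dom C g) (Dom C p1)"
    "p1 \<cdot> h = g" "p \<cdot> h = Id C (Dom C g)"
    using sec by (rule section_pointE)
  show ?thesis
    using pullbackD(4,6,8)[OF s(1)] s(2,4) assms(2-) by (simp add: is_point_iff in_hom)
qed

lemma section_point_exists: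
  assumes lim: "has_finite_limits C" and fg: "f \<in> Arr C" "g \<in> Arr C" "Cod C g = Dom C f"
  obtains p h where "is_section_point C f g p h"
proof -
  obtain p1 p where pb: "is_pullback C f (f \<cdot> g) p1 p"
    using pullback_exists[OF lim, of f "f \<cdot> g"] fg by auto
  have "g \<in> hom C (Dom C g) (Dom C f)" "Id C (Dom C g) \<in> hom C (Dom C g) (Dom C (f \<cdot> g))"
    "f \<cdot> g = f \<cdot> g \<cdot> Id C (Dom C g)"
    using fg by (simp_all add: in_hom)
  then obtain h where "h \<in> hom C (Dom C g) (Dom C p1)" "p1 \<cdot> h = g" "p \<cdot> h = Id C (Dom C g)"
    using pullback_lift[OF pb] by metis
  with pb have "is_section_point C f g p h"
    unfolding is_section_point_def by blast
  then show thesis by (rule that)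
qed

text \<open>Here \<open>f \<cdot> s\<close> is an identity, so \<open>f\<close> itself is a pullback
  of \<open>f\<close> along it, with an identity as the other projection.\<close>

lemma point_section_point:
  assumes "is_point C f s"
  shows "is_section_point C f s f s"
  using assms pullback_id[of f "f \<cdot> s"] unfolding is_section_point_def
  by (intro exI[of _ "Id C (Dom C f)"]) (simp add: is_point_iff in_hom)

text \<open>The section point of a pullback of \<open>(f, g)\<close> along \<open>x\<close> is the pullback of the section point of
  \<open>(f, g)\<close> along the projection \<open>c1\<close>, since both are obtained by pulling \<open>f\<close> back along
  \<open>x \<cdot> c2 = f \<cdot> g \<cdot> c1\<close>.\<close>

lemma section_point_pullback:
  assumes S: "pt_pullback_stable C S"
    and fg: "f \<in> Arr C" "g \<in> Arr C" "Cod C g = Dom C f"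
    and pb: "is_pullback C f x p1 p2" and cb: "is_pullback C (f \<cdot> g) x c1 c2"
    and h: "h \<in> hom C (Dom C c1) (Dom C p1)" "p1 \<cdot> h = g \<cdot> c1" "p2 \<cdot> h = c2"
    and sec: "is_section_point C f g p s" and sec': "is_section_point C p2 h p' s'"
    and mem: "(p, s) \<in> S"
  shows "(p', s') \<in> S"
proof -
  obtain q where s: "is_pullback C f (f \<cdot> g) q p" "s \<in> hom C (Dom C g) (Dom C q)"
    "q \<cdot> s = g" "p \<cdot> s = Id C (Dom C g)"
    using sec by (rule section_pointE)
  obtain q' where s': "is_pullback C p2 (p2 \<cdot> h) q' p'" "s' \<in> hom C (Dom C h) (Dom C q')"
    "q' \<cdot> s' = h" "p' \<cdot> s' = Id C (Dom C h)"
    using sec' by (rule section_pointE)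
  note Dp = pullbackD[OF pb] and Dc = pullbackD[OF cb]
    and Dq = pullbackD[OF s(1)] and Dq' = pullbackD[OF s'(1)]
  have ty: "c1 \<in> hom C (Dom C h) (Dom C g)" "p' \<in> hom C (Dom C q') (Dom C h)"
    "q' \<in> hom C (Dom C q') (Dom C p1)" "p1 \<in> hom C (Dom C p1) (Dom C f)"
    "q \<in> hom C (Dom C q) (Dom C f)" "p \<in> hom C (Dom C q) (Dom C g)"
    "h \<in> hom C (Dom C h) (Dom C p1)" "g \<in> hom C (Dom C g) (Dom C f)"
    using Dp(3,4,6-8) Dc(3,4,6-8) Dq(3,4,6-8) Dq'(3,4,6-8) fg h(1) by (simp_all add: in_hom)
  \<comment> \<open>Pasting gives a pullback of \<open>f\<close> along \<open>x \<cdot> c2\<close>.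
    Rewriting this as \<open>f \<cdot> g \<cdot> c1\<close> makes the rectangle comparable with the
    square \<open>s(1)\<close>, which is then cancelled to give \<open>P\<close>.\<close>
  have R: "is_pullback C f (f \<cdot> g \<cdot> c1) (p1 \<cdot> q') p'"
    using pullback_paste[OF pb s'(1)] Dc(9) h(3) by simp
  have "p1 \<cdot> q' \<in> hom C (Dom C q') (Dom C f)" "c1 \<cdot> p' \<in> hom C (Dom C q') (Dom C (f \<cdot> g))"
    using comp_hom[OF ty(3,4)] comp_hom[OF ty(2,1)] fg by simp_all
  moreover have "f \<cdot> (p1 \<cdot> q') = f \<cdot> g \<cdot> (c1 \<cdot> p')"
    using pullbackD(9)[OF R] assoc[of "f \<cdot> g" c1 p'] fg ty(1,2) by (simp add: in_hom)
  ultimately obtain r where r: "r \<in> hom C (Dom C q') (Dom C q)" "q \<cdot> r = p1 \<cdot> q'" "p \<cdot> r = c1 \<cdot> p'"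
    by (rule pullback_lift[OF s(1)])
  have r': "r \<in> hom C (Dom C (p1 \<cdot> q')) (Dom C q)"
    using r(1) ty(3,4) by (simp add: in_hom)
  have P: "is_pullback C p c1 r p'"
    using pullback_cancel[OF s(1) R _ _ r' r(2,3)] ty(1) fg by (simp add: in_hom)
  \<comment> \<open>\<open>P\<close> identifies only \<open>p'\<close>; this equation, tested
    against \<open>q\<close> and \<open>p\<close>, says that \<open>s'\<close> is the section
    induced by \<open>s\<close>.\<close>
  have "r \<cdot> s' = s \<cdot> c1"
  proof (rule pullback_unique[OF s(1)])
    show "r \<cdot> s' \<in> hom C (Dom C h) (Dom C q)" "s \<cdot> c1 \<in> hom C (Dom C h) (Dom C q)"
      by (rule comp_hom[OF s'(2) r(1)] comp_hom[OF ty(1) s(2)])+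
    have "q \<cdot> (r \<cdot> s') = p1 \<cdot> q' \<cdot> s'"
      using comp_assoc[OF s'(2) r(1) ty(5)] r(2) by simp
    also have "\<dots> = g \<cdot> c1"
      using comp_assoc[OF s'(2) ty(3,4)] s'(3) h(2) by simp
    also have "\<dots> = q \<cdot> (s \<cdot> c1)"
      using comp_assoc[OF ty(1) s(2) ty(5)] s(3) by simp
    finally show "q \<cdot> (r \<cdot> s') = q \<cdot> (s \<cdot> c1)" .
    have "p \<cdot> (r \<cdot> s') = c1 \<cdot> p' \<cdot> s'"
      using comp_assoc[OF s'(2) r(1) ty(6)] r(3) by simp
    also have "\<dots> = c1"
      using comp_assoc[OF s'(2) ty(2,1)] s'(4) id_right[OF ty(1)] by simp
    also have "\<dots> = p \<cdot> (s \<cdot> c1)"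
      using comp_assoc[OF ty(1) s(2) ty(6)] s(4) id_left[OF ty(1)] by simp
    finally show "p \<cdot> (r \<cdot> s') = p \<cdot> (s \<cdot> c1)" .
  qed
  moreover have "s' \<in> hom C (Dom C c1) (Dom C r)" "p' \<cdot> s' = Id C (Dom C c1)"
    using s'(2,4) ty(1) r(1) by (simp_all add: in_hom)
  ultimately show ?thesis
    using S P mem unfolding pt_pullback_stable_def by blast
qed

text \<open>The pullback of \<open>(f, g)\<close> along an identity can be taken to be
  \<open>(f, g)\<close>, so \<open>section_point_pullback\<close> compares two section points of the
  same pair.\<close>

lemma section_point_unique:
  assumes S: "pt_pullback_stable C S"
    and fg: "f \<in> Arr C" "g \<in> Arr C" "Cod C g = Dom C f"
    and sec: "is_section_point C f g p s" "is_section_point C f g p' s'"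
    and mem: "(p, s) \<in> S"
  shows "(p', s') \<in> S"
proof -
  have "is_pullback C f (Id C (Cod C f)) (Id C (Dom C f)) f"
    "is_pullback C (f \<cdot> g) (Id C (Cod C f)) (Id C (Dom C g)) (f \<cdot> g)"
    using pullback_id[of f] pullback_id[of "f \<cdot> g"] fg by simp_all
  then show ?thesis
    using section_point_pullback[OF S fg, of "Id C (Cod C f)" _ f _ "f \<cdot> g" g p s p' s'] fg sec mem
    by (simp add: in_hom)
qed

text \<open>A monomorphism \<open>m\<close> that factors both \<open>g\<close> and the kernel is
  pulled back along \<open>q\<close>. The result factors \<open>s\<close> and \<open>k\<close>, so
  it is invertible by strongness of the section point. Hence \<open>q\<close> factors through
  \<open>m\<close>, and a regular epimorphism factors through no proper monomorphism.\<close>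

lemma strong_of_section_point:
  assumes pt: "pointed C" and lim: "has_finite_limits C" and gp: "is_gen_point C f g"
    and sec: "is_section_point C f g p s" and str: "strong_gen_point C p s"
  shows "strong_gen_point C f g"
proof -
  note fg = gen_pointD[OF gp]
  obtain q where s: "is_pullback C f (f \<cdot> g) q p" "s \<in> hom C (Dom C g) (Dom C q)"
    "q \<cdot> s = g" "p \<cdot> s = Id C (Dom C g)"
    using sec by (rule section_pointE)
  note D = pullbackD[OF s(1)]
  obtain k where k: "is_kernel C p k" "jointly_strongly_epic C s k"
    using str unfolding strong_gen_point_def by blast
  have kt: "k \<in> hom C (Dom C k) (Dom C q)"
    using k(1) D(6) unfolding is_kernel_def in_hom by simp
  have qt: "q \<in> hom C (Dom C q) (Dom C f)"
    using D(3,7) by (simp add: in_hom)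
  have "jointly_strongly_epic C g (q \<cdot> k)"
    unfolding jointly_strongly_epic_def
  proof (intro conjI allI impI)
    have qk: "q \<cdot> k \<in> hom C (Dom C k) (Dom C f)"
      by (rule comp_hom[OF kt qt])
    then show "g \<in> Arr C" "q \<cdot> k \<in> Arr C" "Cod C g = Cod C (q \<cdot> k)"
      using fg by (simp_all add: in_hom)
    fix m assume "is_mono C m \<and> Cod C m = Cod C g \<and>
      (\<exists>u' \<in> hom C (Dom C g) (Dom C m). m \<cdot> u' = g) \<and>
      (\<exists>v' \<in> hom C (Dom C (q \<cdot> k)) (Dom C m). m \<cdot> v' = q \<cdot> k)"
    then obtain u v where m: "is_mono C m" "Cod C m = Dom C f"
      and u: "u \<in> hom C (Dom C g) (Dom C m)" "m \<cdot> u = g"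
      and v: "v \<in> hom C (Dom C k) (Dom C m)" "m \<cdot> v = q \<cdot> k"
      using fg(3) qk[unfolded in_hom] by metis
    have marr: "m \<in> Arr C"
      using m(1) by (simp add: is_mono_def)
    obtain l n where n: "is_pullback C m q l n"
      using pullback_exists[OF lim marr D(3)] m(2) D(7) by auto
    note Dn = pullbackD[OF n]
    obtain u' where u': "u' \<in> hom C (Dom C g) (Dom C l)" "n \<cdot> u' = s"
      using pullback_lift[OF n u(1) s(2)] u(2) s(3) by metis
    obtain v' where v': "v' \<in> hom C (Dom C k) (Dom C l)" "n \<cdot> v' = k"
      using pullback_lift[OF n v(1) kt v(2)] by metis
    have nt: "n \<in> hom C (Dom C l) (Dom C q)"
      using Dn(4,6,8) by (simp add: in_hom)
    have "Cod C n = Cod C s" "Dom C s = Dom C g" "Dom C n = Dom C l"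
      using nt s(2) by (simp_all add: in_hom)
    then have "Cod C n = Cod C s" "\<exists>t \<in> hom C (Dom C s) (Dom C n). n \<cdot> t = s"
      "\<exists>t \<in> hom C (Dom C k) (Dom C n). n \<cdot> t = k"
      using u' v' by auto
    then have "is_iso C n"
      using k(2) mono_pullback[OF n m(1)] unfolding jointly_strongly_epic_def by blast
    then obtain i where "i \<in> hom C (Cod C n) (Dom C n)" "n \<cdot> i = Id C (Cod C n)"
      unfolding is_iso_def by blast
    then have i: "i \<in> hom C (Dom C q) (Dom C l)" "n \<cdot> i = Id C (Dom C q)"
      using nt by (simp_all add: in_hom)
    \<comment> \<open>With \<open>i\<close> inverse to \<open>n\<close>, the arrow
      \<open>l \<cdot> i\<close> is the factorization of \<open>q\<close> through
      \<open>m\<close>.\<close>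
    have "m \<cdot> (l \<cdot> i) = q \<cdot> (n \<cdot> i)"
      using comp_eq_comp[OF Dn(9), of i] Dn i(1) by (simp add: in_hom)
    then have "m \<cdot> (l \<cdot> i) = q" "l \<cdot> i \<in> hom C (Dom C q) (Dom C m)"
      using i Dn(3,7) D(3) by (simp_all add: in_hom)
    moreover have "regular_epi C q"
      \<comment> \<open>\<open>q\<close> is the pullback of \<open>f \<cdot> g\<close> along \<open>f\<close>.\<close>
      using fg(4) pullback_sym[OF s(1)] unfolding pullback_stable_regular_epi_def by blast
    ultimately show "is_iso C m"
      using regular_epi_factor_mono_iso m(1) by blast
  qed
  with kernel_pullback[OF pt s(1) k(1)] gp show ?thesis
    unfolding strong_gen_point_def by blast
qed

section \<open>Limits\<close>

text \<open>The version of \<open>comp_eq_comp\<close> for diagram chases: apart from the square,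
  its premises are memberships in hom sets, which can be supplied by \<open>OF\<close> without
  simplification.\<close>

lemma comp_square:
  assumes "f \<cdot> g = x \<cdot> y" and "h \<in> hom C a b" "g \<in> hom C b c" "f \<in> hom C c d"
    and "y \<in> hom C b e" "x \<in> hom C e d"
  shows "f \<cdot> (g \<cdot> h) = x \<cdot> (y \<cdot> h)"
  using assms comp_assoc[OF assms(2,3,4)] comp_assoc[OF assms(2,5,6)] by simp

lemma functorD:
  assumes "is_functor J C D d"
  shows "i \<in> Obj J \<Longrightarrow> D i \<in> Obj C"
    "u \<in> Arr J \<Longrightarrow> d u \<in> hom C (D (Dom J u)) (D (Cod J u))"
    "i \<in> Obj J \<Longrightarrow> d (Id J i) = Id C (D i)"
    "\<lbrakk>u \<in> Arr J; v \<in> Arr J; Dom J v = Cod J u\<rbrakk> \<Longrightarrow> d (v \<cdot>\<^bsub>J\<^esub> u) = d v \<cdot> d u"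
  using assms by (auto simp: is_functor_def)

lemma coneD:
  assumes "is_cone J C D d L p"
  shows "L \<in> Obj C" "i \<in> Obj J \<Longrightarrow> p i \<in> hom C L (D i)"
    "u \<in> Arr J \<Longrightarrow> d u \<cdot> p (Dom J u) = p (Cod J u)"
  using assms by (auto simp: is_cone_def)

lemma limit_lift:
  assumes "is_limit J C D d L p" "is_cone J C D d X q"
  obtains h where "h \<in> hom C X L" "\<And>i. i \<in> Obj J \<Longrightarrow> p i \<cdot> h = q i"
  using assms unfolding is_limit_def by (metis (no_types, lifting))

lemma cone_precomp:
  assumes J: "category J" and D: "is_functor J C D d" and L: "is_cone J C D d L p"
    and h: "h \<in> hom C X L"
  shows "is_cone J C D d X (\<lambda>i. p i \<cdot> h)"
  unfolding is_cone_def
proof (intro conjI ballI)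
  show "X \<in> Obj C" by (rule hom_obj(1)[OF h])
  show "p i \<cdot> h \<in> hom C X (D i)" if "i \<in> Obj J" for i
    by (rule comp_hom[OF h coneD(2)[OF L that]])
  show "d u \<cdot> (p (Dom J u) \<cdot> h) = p (Cod J u) \<cdot> h" if u: "u \<in> Arr J" for u
    using comp_assoc[OF h coneD(2)[OF L category.dom_obj[OF J u]] functorD(2)[OF D u]]
      coneD(3)[OF L u] by simp
qed

text \<open>Both arrows mediate the cone with legs \<open>p i \<cdot> k\<close>.\<close>

lemma limit_unique:
  assumes J: "category J" and D: "is_functor J C D d" and L: "is_limit J C D d L p"
    and h: "h \<in> hom C X L" and k: "k \<in> hom C X L" and eq: "\<And>i. i \<in> Obj J \<Longrightarrow> p i \<cdot> h = p i \<cdot> k"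
  shows "h = k"
proof -
  have "is_cone J C D d L p"
    using L by (simp add: is_limit_def)
  then have "is_cone J C D d X (\<lambda>i. p i \<cdot> k)"
    by (rule cone_precomp[OF J D _ k])
  then have "\<exists>!t. t \<in> hom C X L \<and> (\<forall>i \<in> Obj J. p i \<cdot> t = p i \<cdot> k)"
    using L by (simp add: is_limit_def)
  then show ?thesis
    using h k eq by (elim ex1E) metis
qed

lemma limitI:
  assumes "is_cone J C D d L p"
    and ex: "\<And>X q. is_cone J C D d X q \<Longrightarrow> \<exists>h \<in> hom C X L. \<forall>i \<in> Obj J. p i \<cdot> h = q i"
    and un: "\<And>X h k. \<lbrakk>h \<in> hom C X L; k \<in> hom C X L; \<And>i. i \<in> Obj J \<Longrightarrow> p i \<cdot> h = p i \<cdot> k\<rbrakk>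
      \<Longrightarrow> h = k"
  shows "is_limit J C D d L p"
  unfolding is_limit_def
proof (intro conjI allI impI assms(1))
  fix X q assume "is_cone J C D d X q"
  from ex[OF this] obtain h where h: "h \<in> hom C X L" "\<forall>i \<in> Obj J. p i \<cdot> h = q i" by blast
  show "\<exists>!h. h \<in> hom C X L \<and> (\<forall>i \<in> Obj J. p i \<cdot> h = q i)"
  proof (rule ex1I[of _ h])
    fix k assume "k \<in> hom C X L \<and> (\<forall>i \<in> Obj J. p i \<cdot> k = q i)"
    then show "k = h" using h by (intro un[of k X h]) auto
  qed (use h in blast)
qed

text \<open>Used to carry the three component limits of a constructed vertex over to an isomorphic
  vertex.\<close>

lemma limit_transport:
  assumes J: "category J" and D: "is_functor J C D d" and L: "is_limit J C D d L p"
    and h: "h \<in> hom C M L" and k: "k \<in> hom C L M"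
    and kh: "k \<cdot> h = Id C M" and hk: "h \<cdot> k = Id C L"
    and q: "\<And>i. i \<in> Obj J \<Longrightarrow> p i \<cdot> h = q i"
  shows "is_limit J C D d M q"
proof (rule limitI)
  have cone: "is_cone J C D d L p"
    using L by (simp add: is_limit_def)
  note cp = cone_precomp[OF J D cone h]
  show "is_cone J C D d M q"
    using cp q category.dom_obj[OF J] category.cod_obj[OF J] unfolding is_cone_def by auto
  have qk: "q i \<cdot> (k \<cdot> t) = p i \<cdot> t" if i: "i \<in> Obj J" and t: "t \<in> hom C X L" for i t X
  proof -
    have "q i \<cdot> (k \<cdot> t) = p i \<cdot> (h \<cdot> (k \<cdot> t))"
      using comp_assoc[OF comp_hom[OF t k] h coneD(2)[OF cone i]] q[OF i] by simp
    also have "h \<cdot> (k \<cdot> t) = t"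
      using comp_assoc[OF t k h] hk id_left[OF t] by simp
    finally show ?thesis .
  qed
  fix X
  {
    fix r assume "is_cone J C D d X r"
    then obtain t where t: "t \<in> hom C X L" "\<And>i. i \<in> Obj J \<Longrightarrow> p i \<cdot> t = r i"
      using limit_lift[OF L] by blast
    then show "\<exists>t \<in> hom C X M. \<forall>i \<in> Obj J. q i \<cdot> t = r i"
      using comp_hom[OF t(1) k] qk by (intro bexI[of _ "k \<cdot> t"]) auto
  next
    fix s t assume st: "s \<in> hom C X M" "t \<in> hom C X M" "\<And>i. i \<in> Obj J \<Longrightarrow> q i \<cdot> s = q i \<cdot> t"
    have ph: "p i \<cdot> (h \<cdot> w) = q i \<cdot> w" if "i \<in> Obj J" "w \<in> hom C X M" for i w
      using comp_assoc[OF that(2) h coneD(2)[OF cone that(1)]] q[OF that(1)] by simp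
    have "h \<cdot> s = h \<cdot> t"
      using limit_unique[OF J D L comp_hom[OF st(1) h] comp_hom[OF st(2) h]] ph st by simp
    then have "k \<cdot> h \<cdot> s = k \<cdot> h \<cdot> t"
      using comp_assoc[OF st(1) h k] comp_assoc[OF st(2) h k] by simp
    then show "s = t"
      using kh id_left[OF st(1)] id_left[OF st(2)] by simp
  }
qed

lemma limit_iso:
  assumes J: "category J" and D: "is_functor J C D d"
    and L: "is_limit J C D d L p" and M: "is_limit J C D d M q"
  obtains h k where "h \<in> hom C M L" "k \<in> hom C L M" "k \<cdot> h = Id C M" "h \<cdot> k = Id C L"
    "\<And>i. i \<in> Obj J \<Longrightarrow> p i \<cdot> h = q i"
proof -
  have cL: "is_cone J C D d L p" and cM: "is_cone J C D d M q"
    using L M by (simp_all add: is_limit_def)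
  obtain h where h: "h \<in> hom C M L" "\<And>i. i \<in> Obj J \<Longrightarrow> p i \<cdot> h = q i"
    using limit_lift[OF L cM] by blast
  obtain k where k: "k \<in> hom C L M" "\<And>i. i \<in> Obj J \<Longrightarrow> q i \<cdot> k = p i"
    using limit_lift[OF M cL] by blast
  have "k \<cdot> h = Id C M"
  proof (rule limit_unique[OF J D M comp_hom[OF h(1) k(1)] id_hom[OF coneD(1)[OF cM]]])
    show "q i \<cdot> (k \<cdot> h) = q i \<cdot> Id C M" if i: "i \<in> Obj J" for i
      using comp_assoc[OF h(1) k(1) coneD(2)[OF cM i]] h(2)[OF i] k(2)[OF i]
        id_right[OF coneD(2)[OF cM i]] by simp
  qed
  moreover have "h \<cdot> k = Id C L"
  proof (rule limit_unique[OF J D L comp_hom[OF k(1) h(1)] id_hom[OF coneD(1)[OF cL]]])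
    show "p i \<cdot> (h \<cdot> k) = p i \<cdot> Id C L" if i: "i \<in> Obj J" for i
      using comp_assoc[OF k(1) h(1) coneD(2)[OF cL i]] h(2)[OF i] k(2)[OF i]
        id_right[OF coneD(2)[OF cL i]] by simp
  qed
  ultimately show thesis
    using that h k by blast
qed

end

text \<open>Diagrams and legs are total functions, but a limit reads them only on the shape. This
  matters for points, whose \<open>B\<close> and \<open>C\<close> components agree only
  there.\<close>

lemma limit_cong:
  assumes J: "category J" and D: "\<And>i. i \<in> Obj J \<Longrightarrow> D i = D' i" and d: "\<And>u. u \<in> Arr J \<Longrightarrow> d u = d' u"
    and p: "\<And>i. i \<in> Obj J \<Longrightarrow> p i = p' i"
  shows "is_limit J C D d L p \<longleftrightarrow> is_limit J C D' d' L p'"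
proof -
  have cone: "is_cone J C D d X q \<longleftrightarrow> is_cone J C D' d' X q" for X q
    unfolding is_cone_def using D d by simp
  have "is_cone J C D' d' L p \<longleftrightarrow> is_cone J C D' d' L p'"
    unfolding is_cone_def using p category.dom_obj[OF J] category.cod_obj[OF J] by simp
  moreover have "(\<forall>i \<in> Obj J. p i \<cdot>\<^bsub>C\<^esub> h = q i) \<longleftrightarrow> (\<forall>i \<in> Obj J. p' i \<cdot>\<^bsub>C\<^esub> h = q i)" for h q
    using p by simp
  ultimately show ?thesis
    unfolding is_limit_def cone by simp
qed

section \<open>Full subcategories\<close>

lemma hom_full_subcategory:
  "hom (full_subcategory C P) a b = (if a \<in> P \<and> b \<in> P then hom C a b else {})"
  by (auto simp: hom_def full_subcategory_def)

lemma full_subcategory_simps [simp]: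
  "Obj (full_subcategory C P) = Obj C \<inter> P" "Dom (full_subcategory C P) = Dom C"
  "Cod (full_subcategory C P) = Cod C" "Id (full_subcategory C P) = Id C"
  "Comp (full_subcategory C P) = Comp C"
  by (simp_all add: full_subcategory_def)

lemma full_subcategory_subset:
  assumes "B \<subseteq> A"
  shows "full_subcategory (full_subcategory C A) B = full_subcategory C B"
  using assms by (auto simp: full_subcategory_def intro!: cat.equality)

lemma category_full_subcategory:
  assumes "category C"
  shows "category (full_subcategory C P)"
proof -
  interpret category C by fact
  show ?thesis
    by unfold_locales
      (auto simp: hom_full_subcategory id_hom split: if_splits
        intro: comp_hom id_left id_right comp_assoc, auto simp: full_subcategory_def)
qed

lemma functor_full_subcategory:
  "is_functor J (full_subcategory C P) D d \<longleftrightarrow>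
    is_functor J C D d \<and> (\<forall>i \<in> Obj J. D i \<in> P)" if "category J"
  using category.dom_obj[OF that] category.cod_obj[OF that]
  unfolding is_functor_def by (auto simp: hom_full_subcategory split: if_splits)

lemma cone_full_subcategory:
  "is_cone J (full_subcategory C P) D d L p \<longleftrightarrow> is_cone J C D d L p \<and> L \<in> P"
  if "\<forall>i \<in> Obj J. D i \<in> P"
  using that unfolding is_cone_def by (auto simp: hom_full_subcategory split: if_splits)

text \<open>By fullness the competing cones and mediating arrows are unchanged. The converse fails
  in general, which is why \<open>Pt_limit_componentwise\<close> goes through a constructed
  limit.\<close>

lemma limit_full_subcategory:
  assumes "is_limit J C D d L p" "L \<in> P" "\<forall>i \<in> Obj J. D i \<in> P"
  shows "is_limit J (full_subcategory C P) D d L p"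
  using assms unfolding is_limit_def cone_full_subcategory[OF assms(3)]
  by (simp add: hom_full_subcategory)

section \<open>Composable pairs\<close>

text \<open>Projections in place of the case patterns in \<open>componentwise_limit\<close>, so that
  equations such as \<open>pair_comp_components\<close> also rewrite arrows given by
  variables.\<close>

definition cA :: "'m pair_arrow \<Rightarrow> 'm" where "cA t = fst (fst (snd t))"
definition cB :: "'m pair_arrow \<Rightarrow> 'm" where "cB t = fst (snd (fst (snd t)))"
definition cC :: "'m pair_arrow \<Rightarrow> 'm" where "cC t = snd (snd (fst (snd t)))"

lemma components [simp]:
  "cA (P, (a, b, c), Q) = a" "cB (P, (a, b, c), Q) = b" "cC (P, (a, b, c), Q) = c"
  by (simp_all add: cA_def cB_def cC_def)

abbreviation oA :: "('o, 'm) cat \<Rightarrow> 'm \<times> 'm \<Rightarrow> 'o" where "oA C P \<equiv> Dom C (fst P)"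
abbreviation oB :: "('o, 'm) cat \<Rightarrow> 'm \<times> 'm \<Rightarrow> 'o" where "oB C P \<equiv> Cod C (fst P)"
abbreviation oC :: "('o, 'm) cat \<Rightarrow> 'm \<times> 'm \<Rightarrow> 'o" where "oC C P \<equiv> Dom C (snd P)"

lemma pair_obj:
  "P \<in> Obj (composable_pairs C) \<longleftrightarrow> snd P \<in> hom C (oC C P) (oA C P) \<and> fst P \<in> hom C (oA C P) (oB C P)"
  by (auto simp: composable_pairs_def in_hom split: prod.splits)

lemma pair_hom:
  "t \<in> hom (composable_pairs C) P Q \<longleftrightarrow>
    P \<in> Obj (composable_pairs C) \<and> Q \<in> Obj (composable_pairs C) \<and> t = (P, (cA t, cB t, cC t), Q) \<and>
    cA t \<in> hom C (oA C P) (oA C Q) \<and> cB t \<in> hom C (oB C P) (oB C Q) \<and> cC t \<in> hom C (oC C P) (oC C Q) \<and>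
    cA t \<cdot>\<^bsub>C\<^esub> snd P = snd Q \<cdot>\<^bsub>C\<^esub> cC t \<and> fst Q \<cdot>\<^bsub>C\<^esub> cA t = cB t \<cdot>\<^bsub>C\<^esub> fst P"
  by (cases t; cases P; cases Q) (auto simp: composable_pairs_def hom_def cA_def cB_def cC_def)

lemma pair_homD:
  assumes "t \<in> hom (composable_pairs C) P Q"
  shows "P \<in> Obj (composable_pairs C)" "Q \<in> Obj (composable_pairs C)" "t = (P, (cA t, cB t, cC t), Q)"
    "cA t \<in> hom C (oA C P) (oA C Q)" "cB t \<in> hom C (oB C P) (oB C Q)" "cC t \<in> hom C (oC C P) (oC C Q)"
    "cA t \<cdot>\<^bsub>C\<^esub> snd P = snd Q \<cdot>\<^bsub>C\<^esub> cC t" "fst Q \<cdot>\<^bsub>C\<^esub> cA t = cB t \<cdot>\<^bsub>C\<^esub> fst P"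
  using assms[unfolded pair_hom] by blast+

lemma pair_objD:
  assumes "P \<in> Obj (composable_pairs C)"
  shows "snd P \<in> hom C (oC C P) (oA C P)" "fst P \<in> hom C (oA C P) (oB C P)"
  using assms[unfolded pair_obj] by blast+

lemma pair_homI:
  assumes "P \<in> Obj (composable_pairs C)" "Q \<in> Obj (composable_pairs C)"
    "a \<in> hom C (oA C P) (oA C Q)" "b \<in> hom C (oB C P) (oB C Q)" "c \<in> hom C (oC C P) (oC C Q)"
    "a \<cdot>\<^bsub>C\<^esub> snd P = snd Q \<cdot>\<^bsub>C\<^esub> c" "fst Q \<cdot>\<^bsub>C\<^esub> a = b \<cdot>\<^bsub>C\<^esub> fst P"
  shows "(P, (a, b, c), Q) \<in> hom (composable_pairs C) P Q"
  unfolding pair_hom components using assms by blast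

lemma pair_eqI:
  assumes "t \<in> hom (composable_pairs C) P Q" "u \<in> hom (composable_pairs C) P Q"
    and "cA t = cA u" "cB t = cB u" "cC t = cC u"
  shows "t = u"
  using pair_homD(3)[OF assms(1)] pair_homD(3)[OF assms(2)] assms(3-) by simp

lemma pair_comp:
  "v \<cdot>\<^bsub>composable_pairs C\<^esub> u =
    (fst u, (cA v \<cdot>\<^bsub>C\<^esub> cA u, cB v \<cdot>\<^bsub>C\<^esub> cB u, cC v \<cdot>\<^bsub>C\<^esub> cC u), snd (snd v))"
  by (cases u; cases v) (auto simp: composable_pairs_def cA_def cB_def cC_def)

lemma pair_id:
  "Id (composable_pairs C) P = (P, (Id C (oA C P), Id C (oB C P), Id C (oC C P)), P)"
  by (cases P) (simp add: composable_pairs_def)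

lemma pair_comp_components [simp]:
  "cA (v \<cdot>\<^bsub>composable_pairs C\<^esub> u) = cA v \<cdot>\<^bsub>C\<^esub> cA u"
  "cB (v \<cdot>\<^bsub>composable_pairs C\<^esub> u) = cB v \<cdot>\<^bsub>C\<^esub> cB u"
  "cC (v \<cdot>\<^bsub>composable_pairs C\<^esub> u) = cC v \<cdot>\<^bsub>C\<^esub> cC u"
  by (simp_all add: pair_comp)

lemma pair_id_components [simp]:
  "cA (Id (composable_pairs C) P) = Id C (oA C P)" "cB (Id (composable_pairs C) P) = Id C (oB C P)"
  "cC (Id (composable_pairs C) P) = Id C (oC C P)"
  by (simp_all add: pair_id)

lemma componentwise_limit_iff:
  "componentwise_limit J C D d L p \<longleftrightarrow> is_cone J (composable_pairs C) D d L p \<and>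
    is_limit J C (\<lambda>i. oA C (D i)) (\<lambda>u. cA (d u)) (oA C L) (\<lambda>i. cA (p i)) \<and>
    is_limit J C (\<lambda>i. oB C (D i)) (\<lambda>u. cB (d u)) (oB C L) (\<lambda>i. cB (p i)) \<and>
    is_limit J C (\<lambda>i. oC C (D i)) (\<lambda>u. cC (d u)) (oC C L) (\<lambda>i. cC (p i))"
  unfolding componentwise_limit_def Let_def comp_def cA_def cB_def cC_def
  by (simp add: case_prod_beta)

context category
begin

lemma category_composable_pairs: "category (composable_pairs C)"
proof -
  let ?K = "composable_pairs C"
  \<comment> \<open>Typing of composites comes first, because \<open>pair_eqI\<close>, which proves
    the category laws, needs both sides typed.\<close>
  have comp: "v \<cdot>\<^bsub>?K\<^esub> u \<in> hom ?K P R" if u: "u \<in> hom ?K P Q" and v: "v \<in> hom ?K Q R" for u v P Q R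
  proof -
    note U = pair_homD[OF u] and V = pair_homD[OF v]
    note P = pair_objD[OF U(1)] and Q = pair_objD[OF U(2)] and R = pair_objD[OF V(2)]
    have "cA v \<cdot> cA u \<cdot> snd P = cA v \<cdot> (snd Q \<cdot> cC u)"
      using comp_assoc[OF P(1) U(4) V(4)] U(7) by simp
    also have "\<dots> = snd R \<cdot> (cC v \<cdot> cC u)"
      by (rule comp_square[OF V(7) U(6) Q(1) V(4) V(6) R(1)])
    finally have 1: "cA v \<cdot> cA u \<cdot> snd P = snd R \<cdot> (cC v \<cdot> cC u)" .
    have "fst R \<cdot> (cA v \<cdot> cA u) = cB v \<cdot> (fst Q \<cdot> cA u)"
      by (rule comp_square[OF V(8) U(4) V(4) R(2) Q(2) V(5)])
    also have "\<dots> = cB v \<cdot> cB u \<cdot> fst P"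
      using comp_assoc[OF P(2) U(5) V(5)] U(8) by simp
    finally have 2: "fst R \<cdot> (cA v \<cdot> cA u) = cB v \<cdot> cB u \<cdot> fst P" .
    have "fst u = P" "snd (snd v) = R"
      using arg_cong[OF U(3), of fst] arg_cong[OF V(3), of "snd \<circ> snd"] by simp_all
    then show ?thesis
      unfolding pair_comp
      using pair_homI[OF U(1) V(2) comp_hom[OF U(4) V(4)] comp_hom[OF U(5) V(5)]
          comp_hom[OF U(6) V(6)] 1 2] by simp
  qed
  have id: "Id ?K P \<in> hom ?K P P" if P: "P \<in> Obj ?K" for P
  proof -
    note Q = pair_objD[OF P]
    show ?thesis
      unfolding pair_id
      using P id_hom[OF hom_obj(1)[OF Q(2)]] id_hom[OF hom_obj(2)[OF Q(2)]] id_hom[OF hom_obj(1)[OF Q(1)]]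
        id_left[OF Q(1)] id_right[OF Q(1)] id_left[OF Q(2)] id_right[OF Q(2)]
      by (intro pair_homI) auto
  qed
  show ?thesis
  proof
    show "Dom ?K t \<in> Obj ?K" "Cod ?K t \<in> Obj ?K" if "t \<in> Arr ?K" for t
      using that pair_homD(1,2)[of t C "Dom ?K t" "Cod ?K t"] by (simp_all add: in_hom)
    show "Id ?K b \<cdot>\<^bsub>?K\<^esub> f = f" if f: "f \<in> hom ?K a b" for f a b
      using comp[OF f id[OF pair_homD(2)[OF f]]] f
        id_left[OF pair_homD(4)[OF f]] id_left[OF pair_homD(5)[OF f]] id_left[OF pair_homD(6)[OF f]]
      by (intro pair_eqI) auto
    show "f \<cdot>\<^bsub>?K\<^esub> Id ?K a = f" if f: "f \<in> hom ?K a b" for f a b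
      using comp[OF id[OF pair_homD(1)[OF f]] f] f
        id_right[OF pair_homD(4)[OF f]] id_right[OF pair_homD(5)[OF f]] id_right[OF pair_homD(6)[OF f]]
      by (intro pair_eqI) auto
    show "(f \<cdot>\<^bsub>?K\<^esub> g) \<cdot>\<^bsub>?K\<^esub> h = f \<cdot>\<^bsub>?K\<^esub> (g \<cdot>\<^bsub>?K\<^esub> h)"
      if h: "h \<in> hom ?K a b" and g: "g \<in> hom ?K b c" and f: "f \<in> hom ?K c d" for f g h a b c d
    proof (rule pair_eqI)
      show "f \<cdot>\<^bsub>?K\<^esub> g \<cdot>\<^bsub>?K\<^esub> h \<in> hom ?K a d" "f \<cdot>\<^bsub>?K\<^esub> (g \<cdot>\<^bsub>?K\<^esub> h) \<in> hom ?K a d"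
        using comp h g f by blast+
    qed (use comp_assoc[OF pair_homD(4)[OF h] pair_homD(4)[OF g] pair_homD(4)[OF f]]
      comp_assoc[OF pair_homD(5)[OF h] pair_homD(5)[OF g] pair_homD(5)[OF f]]
      comp_assoc[OF pair_homD(6)[OF h] pair_homD(6)[OF g] pair_homD(6)[OF f]] in simp_all)
  qed (use id comp in blast)+
qed

lemma pair_functor_components:
  assumes "is_functor J (composable_pairs C) D d"
  shows "is_functor J C (\<lambda>i. oA C (D i)) (\<lambda>u. cA (d u))"
    "is_functor J C (\<lambda>i. oB C (D i)) (\<lambda>u. cB (d u))"
    "is_functor J C (\<lambda>i. oC C (D i)) (\<lambda>u. cC (d u))"
proof -
  let ?K = "composable_pairs C"
  note F = category.functorD[OF category_composable_pairs assms(1)]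
  note O = pair_objD[OF F(1)] and A = pair_homD[OF F(2)]
  show "is_functor J C (\<lambda>i. oA C (D i)) (\<lambda>u. cA (d u))"
    "is_functor J C (\<lambda>i. oB C (D i)) (\<lambda>u. cB (d u))"
    "is_functor J C (\<lambda>i. oC C (D i)) (\<lambda>u. cC (d u))"
    unfolding is_functor_def
    using hom_obj[OF O(1)] hom_obj[OF O(2)] A(4-6) F(3,4) by simp_all
qed

lemma pair_cone_components:
  assumes "is_cone J (composable_pairs C) D d L p"
  shows "is_cone J C (\<lambda>i. oA C (D i)) (\<lambda>u. cA (d u)) (oA C L) (\<lambda>i. cA (p i))"
    "is_cone J C (\<lambda>i. oB C (D i)) (\<lambda>u. cB (d u)) (oB C L) (\<lambda>i. cB (p i))"
    "is_cone J C (\<lambda>i. oC C (D i)) (\<lambda>u. cC (d u)) (oC C L) (\<lambda>i. cC (p i))"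
proof -
  note F = category.coneD[OF category_composable_pairs assms(1)]
  note O = pair_objD[OF F(1)] and A = pair_homD[OF F(2)]
  have "cA (d u) \<cdot> cA (p (Dom J u)) = cA (p (Cod J u))" "cB (d u) \<cdot> cB (p (Dom J u)) = cB (p (Cod J u))"
    "cC (d u) \<cdot> cC (p (Dom J u)) = cC (p (Cod J u))" if "u \<in> Arr J" for u
    using arg_cong[OF F(3)[OF that], of cA] arg_cong[OF F(3)[OF that], of cB]
      arg_cong[OF F(3)[OF that], of cC] by simp_all
  then show "is_cone J C (\<lambda>i. oA C (D i)) (\<lambda>u. cA (d u)) (oA C L) (\<lambda>i. cA (p i))"
    "is_cone J C (\<lambda>i. oB C (D i)) (\<lambda>u. cB (d u)) (oB C L) (\<lambda>i. cB (p i))"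
    "is_cone J C (\<lambda>i. oC C (D i)) (\<lambda>u. cC (d u)) (oC C L) (\<lambda>i. cC (p i))"
    unfolding is_cone_def
    using hom_obj[OF O(1)] hom_obj[OF O(2)] A(4-6) by simp_all
qed

text \<open>The mediating arrows \<open>a\<close>, \<open>b\<close>, \<open>c\<close> of the
  components form an arrow of pairs: the square over \<open>A\<close> can be tested on the legs
  \<open>cA (p i)\<close>, the square over \<open>B\<close> on the legs
  \<open>cB (p i)\<close>.\<close>

lemma componentwise_limit_is_limit:
  assumes J: "category J" and F: "is_functor J (composable_pairs C) D d"
    and L: "componentwise_limit J C D d L p"
  shows "is_limit J (composable_pairs C) D d L p"
proof (rule category.limitI[OF category_composable_pairs])
  let ?K = "composable_pairs C"
  interpret K: category ?K by (rule category_composable_pairs)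
  note lim = L[unfolded componentwise_limit_iff]
  have LA: "is_limit J C (\<lambda>i. oA C (D i)) (\<lambda>u. cA (d u)) (oA C L) (\<lambda>i. cA (p i))"
    and LB: "is_limit J C (\<lambda>i. oB C (D i)) (\<lambda>u. cB (d u)) (oB C L) (\<lambda>i. cB (p i))"
    and LC: "is_limit J C (\<lambda>i. oC C (D i)) (\<lambda>u. cC (d u)) (oC C L) (\<lambda>i. cC (p i))"
    and cone: "is_cone J ?K D d L p"
    using lim by blast+
  note FA = pair_functor_components(1)[OF F]
    and FB = pair_functor_components(2)[OF F]
    and FC = pair_functor_components(3)[OF F]
  note p = pair_homD[OF K.coneD(2)[OF cone]] and Lobj = pair_objD[OF K.coneD(1)[OF cone]]
  show "is_cone J ?K D d L p" by fact
  fix X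
  {
    fix q assume q: "is_cone J ?K D d X q"
    note qc = pair_cone_components[OF q]
    note Q = pair_homD[OF K.coneD(2)[OF q]] and Xobj = pair_objD[OF K.coneD(1)[OF q]]
    obtain a where a: "a \<in> hom C (oA C X) (oA C L)" "\<And>i. i \<in> Obj J \<Longrightarrow> cA (p i) \<cdot> a = cA (q i)"
      using limit_lift[OF LA qc(1)] by blast
    obtain b where b: "b \<in> hom C (oB C X) (oB C L)" "\<And>i. i \<in> Obj J \<Longrightarrow> cB (p i) \<cdot> b = cB (q i)"
      using limit_lift[OF LB qc(2)] by blast
    obtain c where c: "c \<in> hom C (oC C X) (oC C L)" "\<And>i. i \<in> Obj J \<Longrightarrow> cC (p i) \<cdot> c = cC (q i)"
      using limit_lift[OF LC qc(3)] by blast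
    have 1: "a \<cdot> snd X = snd L \<cdot> c"
    proof (rule limit_unique[OF J FA LA comp_hom[OF Xobj(1) a(1)] comp_hom[OF c(1) Lobj(1)]])
      fix i assume i: "i \<in> Obj J"
      have "cA (p i) \<cdot> (a \<cdot> snd X) = cA (q i) \<cdot> snd X"
        using comp_assoc[OF Xobj(1) a(1) p(4)[OF i]] a(2)[OF i] by simp
      also have "\<dots> = snd (D i) \<cdot> (cC (p i) \<cdot> c)"
        using Q(7)[OF i] c(2)[OF i] by simp
      also have "\<dots> = cA (p i) \<cdot> (snd L \<cdot> c)"
        by (rule comp_square[OF p(7)[OF i, symmetric] c(1) p(6)[OF i] pair_objD(1)[OF p(2)[OF i]]
              Lobj(1) p(4)[OF i]])
      finally show "cA (p i) \<cdot> (a \<cdot> snd X) = cA (p i) \<cdot> (snd L \<cdot> c)" .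
    qed
    have 2: "fst L \<cdot> a = b \<cdot> fst X"
    proof (rule limit_unique[OF J FB LB comp_hom[OF a(1) Lobj(2)] comp_hom[OF Xobj(2) b(1)]])
      fix i assume i: "i \<in> Obj J"
      have "cB (p i) \<cdot> (fst L \<cdot> a) = fst (D i) \<cdot> (cA (p i) \<cdot> a)"
        by (rule comp_square[OF p(8)[OF i, symmetric] a(1) Lobj(2) p(5)[OF i] p(4)[OF i]
              pair_objD(2)[OF p(2)[OF i]]])
      also have "\<dots> = cB (q i) \<cdot> fst X"
        using Q(8)[OF i] a(2)[OF i] by simp
      also have "\<dots> = cB (p i) \<cdot> (b \<cdot> fst X)"
        using comp_assoc[OF Xobj(2) b(1) p(5)[OF i]] b(2)[OF i] by simp
      finally show "cB (p i) \<cdot> (fst L \<cdot> a) = cB (p i) \<cdot> (b \<cdot> fst X)" .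
    qed
    let ?t = "(X, (a, b, c), L)"
    have t: "?t \<in> hom ?K X L"
      by (rule pair_homI[OF K.coneD(1)[OF q] K.coneD(1)[OF cone] a(1) b(1) c(1) 1 2])
    moreover have "p i \<cdot>\<^bsub>?K\<^esub> ?t = q i" if i: "i \<in> Obj J" for i
      by (rule pair_eqI[OF K.comp_hom[OF t K.coneD(2)[OF cone i]] K.coneD(2)[OF q i]])
        (simp_all add: a(2)[OF i] b(2)[OF i] c(2)[OF i])
    ultimately show "\<exists>t \<in> hom ?K X L. \<forall>i \<in> Obj J. p i \<cdot>\<^bsub>?K\<^esub> t = q i"
      by blast
  next
    fix h k assume h: "h \<in> hom ?K X L" and k: "k \<in> hom ?K X L"
      and eq: "\<And>i. i \<in> Obj J \<Longrightarrow> p i \<cdot>\<^bsub>?K\<^esub> h = p i \<cdot>\<^bsub>?K\<^esub> k"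
    note H = pair_homD[OF h] and K = pair_homD[OF k]
    have e: "cA (p i) \<cdot> cA h = cA (p i) \<cdot> cA k" "cB (p i) \<cdot> cB h = cB (p i) \<cdot> cB k"
      "cC (p i) \<cdot> cC h = cC (p i) \<cdot> cC k" if "i \<in> Obj J" for i
      using arg_cong[OF eq[OF that], of cA] arg_cong[OF eq[OF that], of cB]
        arg_cong[OF eq[OF that], of cC] by simp_all
    show "h = k"
      using limit_unique[OF J FA LA H(4) K(4) e(1)] limit_unique[OF J FB LB H(5) K(5) e(2)]
        limit_unique[OF J FC LC H(6) K(6) e(3)]
      by (intro pair_eqI[OF h k]) blast+
  }
qed

section \<open>Limits of points\<close>

lemma Pt_eq: "Pt C = full_subcategory (composable_pairs C) {(f, g). is_point C f g}"
  unfolding Pt_def GPt_def by (rule full_subcategory_subset) (auto simp: is_point_def)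

text \<open>For an arrow (\<alpha>, \<beta>, \<gamma>) from (f, s) to (f', s'), one has \<beta> =
  \<beta> f s = f' \<alpha> s = f' s' \<gamma> = \<gamma>.\<close>

lemma point_arrow_components:
  assumes t: "t \<in> hom (composable_pairs C) P Q"
    and P: "is_point C (fst P) (snd P)" and Q: "is_point C (fst Q) (snd Q)"
  shows "cB t = cC t"
proof -
  note T = pair_homD[OF t]
  note PO = pair_objD[OF T(1)] and QO = pair_objD[OF T(2)]
  have eqP: "oC C P = oB C P" "fst P \<cdot> snd P = Id C (oB C P)"
    and eqQ: "oC C Q = oB C Q" "fst Q \<cdot> snd Q = Id C (oB C Q)"
    using P Q by (simp_all add: is_point_iff)
  have "cB t = cB t \<cdot> (fst P \<cdot> snd P)"
    using eqP id_right[OF T(5)] by simp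
  also have "\<dots> = fst Q \<cdot> (cA t \<cdot> snd P)"
    by (rule comp_square[OF T(8)[symmetric] PO(1) PO(2) T(5) T(4) QO(2)])
  also have "\<dots> = fst Q \<cdot> snd Q \<cdot> cC t"
    using T(7) comp_assoc[OF T(6) QO] by simp
  also have "\<dots> = cC t"
    using eqQ id_left[OF T(6)] by simp
  finally show ?thesis .
qed

text \<open>Only the limits over \<open>A\<close> and \<open>B\<close> are chosen; the latter also
  serves as the limit over \<open>C\<close>. The pair \<open>(f, s)\<close> is induced between them,
  and the legs \<open>b i\<close> detect that \<open>f \<cdot> s\<close> is an identity.\<close>

lemma point_componentwise_limit_exists:
  assumes lim: "has_finite_limits C" and J: "finite_category J"
    and F: "is_functor J (composable_pairs C) D d"
    and pts: "\<And>i. i \<in> Obj J \<Longrightarrow> is_point C (fst (D i)) (snd (D i))"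
  obtains L p where "componentwise_limit J C D d L p" "is_point C (fst L) (snd L)"
proof -
  let ?K = "composable_pairs C"
  interpret K: category ?K by (rule category_composable_pairs)
  have Jc: "category J"
    using J by (simp add: finite_category_def)
  note FA = pair_functor_components(1)[OF F]
    and FB = pair_functor_components(2)[OF F]
  obtain A a where A: "is_limit J C (\<lambda>i. oA C (D i)) (\<lambda>u. cA (d u)) A a"
    using lim J FA unfolding has_finite_limits_def by blast
  obtain B b where B: "is_limit J C (\<lambda>i. oB C (D i)) (\<lambda>u. cB (d u)) B b"
    using lim J FB unfolding has_finite_limits_def by blast
  have cA: "is_cone J C (\<lambda>i. oA C (D i)) (\<lambda>u. cA (d u)) A a"
    and cB: "is_cone J C (\<lambda>i. oB C (D i)) (\<lambda>u. cB (d u)) B b"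
    using A B by (simp_all add: is_limit_def)
  note O = pair_objD[OF K.functorD(1)[OF F]] and M = pair_homD[OF K.functorD(2)[OF F]]
  have pt: "oC C (D i) = oB C (D i)" "fst (D i) \<cdot> snd (D i) = Id C (oB C (D i))" if "i \<in> Obj J" for i
    using pts[OF that] by (simp_all add: is_point_iff)
  have S: "snd (D i) \<in> hom C (oB C (D i)) (oA C (D i))" if "i \<in> Obj J" for i
    using O(1)[OF that] pt(1)[OF that] by simp
  have bc: "cB (d u) = cC (d u)" if "u \<in> Arr J" for u
    using point_arrow_components[OF K.functorD(2)[OF F that]] pts
      category.dom_obj[OF Jc that] category.cod_obj[OF Jc that] by blast
  have "is_cone J C (\<lambda>i. oB C (D i)) (\<lambda>u. cB (d u)) A (\<lambda>i. fst (D i) \<cdot> a i)"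
    unfolding is_cone_def
  proof (intro conjI ballI)
    show "A \<in> Obj C" by (rule coneD(1)[OF cA])
    show "fst (D i) \<cdot> a i \<in> hom C A (oB C (D i))" if "i \<in> Obj J" for i
      by (rule comp_hom[OF coneD(2)[OF cA that] O(2)[OF that]])
    fix u assume u: "u \<in> Arr J"
    note du = category.dom_obj[OF Jc u] and cu = category.cod_obj[OF Jc u]
    have "cB (d u) \<cdot> (fst (D (Dom J u)) \<cdot> a (Dom J u)) = fst (D (Cod J u)) \<cdot> (cA (d u) \<cdot> a (Dom J u))"
      by (rule comp_square[OF M(8)[OF u, symmetric] coneD(2)[OF cA du] O(2)[OF du] M(5)[OF u]
            M(4)[OF u] O(2)[OF cu]])
    then show "cB (d u) \<cdot> (fst (D (Dom J u)) \<cdot> a (Dom J u)) = fst (D (Cod J u)) \<cdot> a (Cod J u)"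
      using coneD(3)[OF cA u] by simp
  qed
  then obtain f where f: "f \<in> hom C A B" "\<And>i. i \<in> Obj J \<Longrightarrow> b i \<cdot> f = fst (D i) \<cdot> a i"
    using limit_lift[OF B] by blast
  have "is_cone J C (\<lambda>i. oA C (D i)) (\<lambda>u. cA (d u)) B (\<lambda>i. snd (D i) \<cdot> b i)"
    unfolding is_cone_def
  proof (intro conjI ballI)
    show "B \<in> Obj C" by (rule coneD(1)[OF cB])
    show "snd (D i) \<cdot> b i \<in> hom C B (oA C (D i))" if "i \<in> Obj J" for i
      by (rule comp_hom[OF coneD(2)[OF cB that] S[OF that]])
    fix u assume u: "u \<in> Arr J"
    note du = category.dom_obj[OF Jc u] and cu = category.cod_obj[OF Jc u]
    \<comment> \<open>The square for the sections involves \<open>cC (d u)\<close>, but the legs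
      \<open>b\<close> are compatible with \<open>cB (d u)\<close>; \<open>bc\<close> reconciles the
      two.\<close>
    have "cA (d u) \<cdot> (snd (D (Dom J u)) \<cdot> b (Dom J u)) = snd (D (Cod J u)) \<cdot> (cB (d u) \<cdot> b (Dom J u))"
      by (rule comp_square[OF M(7)[OF u, folded bc[OF u]] coneD(2)[OF cB du] S[OF du] M(4)[OF u]
            M(5)[OF u] S[OF cu]])
    then show "cA (d u) \<cdot> (snd (D (Dom J u)) \<cdot> b (Dom J u)) = snd (D (Cod J u)) \<cdot> b (Cod J u)"
      using coneD(3)[OF cB u] by simp
  qed
  then obtain s where s: "s \<in> hom C B A" "\<And>i. i \<in> Obj J \<Longrightarrow> a i \<cdot> s = snd (D i) \<cdot> b i"
    using limit_lift[OF A] by blast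
  have "f \<cdot> s = Id C B"
  proof (rule limit_unique[OF Jc FB B comp_hom[OF s(1) f(1)] id_hom[OF coneD(1)[OF cB]]])
    fix i assume i: "i \<in> Obj J"
    have "b i \<cdot> (f \<cdot> s) = fst (D i) \<cdot> (a i \<cdot> s)"
      by (rule comp_square[OF f(2)[OF i] s(1) f(1) coneD(2)[OF cB i] coneD(2)[OF cA i] O(2)[OF i]])
    also have "\<dots> = b i"
      using s(2)[OF i] comp_assoc[OF coneD(2)[OF cB i] S[OF i] O(2)[OF i]] pt(2)[OF i]
        id_left[OF coneD(2)[OF cB i]] by simp
    finally show "b i \<cdot> (f \<cdot> s) = b i \<cdot> Id C B"
      using id_right[OF coneD(2)[OF cB i]] by simp
  qed
  with f(1) s(1) have point: "is_point C (fst (f, s)) (snd (f, s))"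
    by (simp add: is_point_iff in_hom)
  let ?p = "\<lambda>i. ((f, s), (a i, b i, b i), D i)"
  have fs: "(f, s) \<in> Obj ?K"
    using f(1) s(1) by (simp add: pair_obj in_hom)
  have ob: "oA C (f, s) = A" "oB C (f, s) = B" "oC C (f, s) = B"
    using f(1) s(1) by (simp_all add: in_hom)
  have p: "?p i \<in> hom ?K (f, s) (D i)" if i: "i \<in> Obj J" for i
  proof (rule pair_homI[OF fs K.functorD(1)[OF F i]], unfold ob pt(1)[OF i])
    show "a i \<in> hom C A (oA C (D i))" "b i \<in> hom C B (oB C (D i))" "b i \<in> hom C B (oB C (D i))"
      by (rule coneD(2)[OF cA i] coneD(2)[OF cB i])+
  qed (use f(2)[OF i] s(2)[OF i] in simp_all)
  have "is_cone J ?K D d (f, s) ?p"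
    unfolding is_cone_def
  proof (intro conjI ballI)
    fix u assume u: "u \<in> Arr J"
    show "d u \<cdot>\<^bsub>?K\<^esub> ?p (Dom J u) = ?p (Cod J u)"
    proof (rule pair_eqI)
      show "d u \<cdot>\<^bsub>?K\<^esub> ?p (Dom J u) \<in> hom ?K (f, s) (D (Cod J u))"
        by (rule K.comp_hom[OF p[OF category.dom_obj[OF Jc u]] K.functorD(2)[OF F u]])
      show "?p (Cod J u) \<in> hom ?K (f, s) (D (Cod J u))"
        by (rule p[OF category.cod_obj[OF Jc u]])
    qed (use coneD(3)[OF cA u] coneD(3)[OF cB u] bc[OF u] in simp_all)
  qed (use fs p in blast)+
  moreover have "is_limit J C (\<lambda>i. oC C (D i)) (\<lambda>u. cC (d u)) B b"
    using B limit_cong[OF Jc, of "\<lambda>i. oC C (D i)" "\<lambda>i. oB C (D i)" "\<lambda>u. cC (d u)" "\<lambda>u. cB (d u)" b b C B]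
      pt(1) bc by simp
  ultimately have "componentwise_limit J C D d (f, s) ?p"
    unfolding componentwise_limit_iff ob components using A B by blast
  then show thesis
    using that point by blast
qed

text \<open>The component-wise limit \<open>M\<close> constructed above is also a limit in
  \<open>Pt C\<close>, hence isomorphic there to \<open>L\<close>. The components of this
  isomorphism are isomorphisms in \<open>C\<close>, along which the component limits are
  transported.\<close>

lemma Pt_limit_componentwise:
  assumes lim: "has_finite_limits C" and J: "finite_category J"
    and F: "is_functor J (Pt C) D d" and L: "is_limit J (Pt C) D d L p"
  shows "componentwise_limit J C D d L p"
proof -
  let ?K = "composable_pairs C" and ?P = "{(f, g). is_point C f g}"
  have Jc: "category J"
    using J by (simp add: finite_category_def)
  interpret P: category "Pt C"
    unfolding Pt_eq by (rule category_full_subcategory[OF category_composable_pairs])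
  have FP: "is_functor J ?K D d \<and> (\<forall>i \<in> Obj J. D i \<in> ?P)"
    using F unfolding Pt_eq functor_full_subcategory[OF Jc] .
  note FK = conjunct1[OF FP] and pts = conjunct2[OF FP]
  obtain M q where M: "componentwise_limit J C D d M q" and Mp: "is_point C (fst M) (snd M)"
    using point_componentwise_limit_exists[OF lim J FK] pts by (auto simp: case_prod_beta)
  have "is_limit J (Pt C) D d M q"
    unfolding Pt_eq
  proof (rule limit_full_subcategory[OF componentwise_limit_is_limit[OF Jc FK M]])
    show "M \<in> ?P"
      using Mp by (simp add: case_prod_beta)
    show "\<forall>i \<in> Obj J. D i \<in> ?P"
      by (rule pts)
  qed
  then obtain h k where h: "h \<in> hom (Pt C) L M" and k: "k \<in> hom (Pt C) M L"
    and kh: "k \<cdot>\<^bsub>Pt C\<^esub> h = Id (Pt C) L" and hk: "h \<cdot>\<^bsub>Pt C\<^esub> k = Id (Pt C) M"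
    and qh: "\<And>i. i \<in> Obj J \<Longrightarrow> q i \<cdot>\<^bsub>Pt C\<^esub> h = p i"
    using P.limit_iso[OF Jc F _ L] by blast
  have H: "h \<in> hom ?K L M" "k \<in> hom ?K M L"
    using h k unfolding Pt_eq by (auto simp: hom_full_subcategory split: if_splits)
  note HD = pair_homD[OF H(1)] and KD = pair_homD[OF H(2)]
  have inv: "cA k \<cdot> cA h = Id C (oA C L)" "cB k \<cdot> cB h = Id C (oB C L)" "cC k \<cdot> cC h = Id C (oC C L)"
    "cA h \<cdot> cA k = Id C (oA C M)" "cB h \<cdot> cB k = Id C (oB C M)" "cC h \<cdot> cC k = Id C (oC C M)"
    using arg_cong[OF kh, of cA] arg_cong[OF kh, of cB] arg_cong[OF kh, of cC]
      arg_cong[OF hk, of cA] arg_cong[OF hk, of cB] arg_cong[OF hk, of cC]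
    by (simp_all add: Pt_eq)
  have e: "cA (q i) \<cdot> cA h = cA (p i)" "cB (q i) \<cdot> cB h = cB (p i)" "cC (q i) \<cdot> cC h = cC (p i)"
    if "i \<in> Obj J" for i
    using arg_cong[OF qh[OF that], of cA] arg_cong[OF qh[OF that], of cB]
      arg_cong[OF qh[OF that], of cC] by (simp_all add: Pt_eq)
  have "is_cone J (Pt C) D d L p"
    using L by (simp add: is_limit_def)
  then have cone: "is_cone J ?K D d L p"
    unfolding Pt_eq cone_full_subcategory[OF pts] by blast
  have MA: "is_limit J C (\<lambda>i. oA C (D i)) (\<lambda>u. cA (d u)) (oA C M) (\<lambda>i. cA (q i))"
    and MB: "is_limit J C (\<lambda>i. oB C (D i)) (\<lambda>u. cB (d u)) (oB C M) (\<lambda>i. cB (q i))"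
    and MC: "is_limit J C (\<lambda>i. oC C (D i)) (\<lambda>u. cC (d u)) (oC C M) (\<lambda>i. cC (q i))"
    using M unfolding componentwise_limit_iff by blast+
  note FC = pair_functor_components[OF FK]
  show ?thesis
    unfolding componentwise_limit_iff
  proof (intro conjI cone)
    show "is_limit J C (\<lambda>i. oA C (D i)) (\<lambda>u. cA (d u)) (oA C L) (\<lambda>i. cA (p i))"
      by (rule limit_transport[OF Jc FC(1) MA HD(4) KD(4) inv(1,4)]) (rule e(1))
    show "is_limit J C (\<lambda>i. oB C (D i)) (\<lambda>u. cB (d u)) (oB C L) (\<lambda>i. cB (p i))"
      by (rule limit_transport[OF Jc FC(2) MB HD(5) KD(5) inv(2,5)]) (rule e(2))
    show "is_limit J C (\<lambda>i. oC C (D i)) (\<lambda>u. cC (d u)) (oC C L) (\<lambda>i. cC (p i))"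
      by (rule limit_transport[OF Jc FC(3) MC HD(6) KD(6) inv(3,6)]) (rule e(3))
  qed
qed

section \<open>Limits of section points\<close>

text \<open>Exposes the projection \<pi> that \<open>is_section_point\<close> hides under a
  quantifier, so that it can be chosen as a family over a diagram.\<close>

definition section_data :: "'m \<times> 'm \<Rightarrow> 'm \<Rightarrow> 'm \<Rightarrow> 'm \<Rightarrow> bool" where
  "section_data P \<pi> r s \<longleftrightarrow> is_pullback C (fst P) (fst P \<cdot> snd P) \<pi> r \<and>
    s \<in> hom C (oC C P) (Dom C \<pi>) \<and> \<pi> \<cdot> s = snd P \<and> r \<cdot> s = Id C (oC C P)"

lemma is_section_point_iff: "is_section_point C f g r s \<longleftrightarrow> (\<exists>\<pi>. section_data (f, g) \<pi> r s)"
  by (simp add: is_section_point_def section_data_def)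

context
  fixes P \<pi> r s
  assumes P: "P \<in> Obj (composable_pairs C)" and sec: "section_data P \<pi> r s"
begin

lemma section_dataD:
  "\<pi> \<in> hom C (Dom C \<pi>) (oA C P)" "r \<in> hom C (Dom C \<pi>) (oC C P)" "s \<in> hom C (oC C P) (Dom C \<pi>)"
  "\<pi> \<cdot> s = snd P" "r \<cdot> s = Id C (oC C P)" "fst P \<cdot> \<pi> = fst P \<cdot> (snd P \<cdot> r)"
proof -
  note PO = pair_objD[OF P]
  have pb: "is_pullback C (fst P) (fst P \<cdot> snd P) \<pi> r"
    using sec by (simp add: section_data_def)
  note D = pullbackD[OF pb]
  have "Dom C (fst P \<cdot> snd P) = oC C P"
    using comp_hom[OF PO] by (simp add: in_hom)
  then show "\<pi> \<in> hom C (Dom C \<pi>) (oA C P)" and r: "r \<in> hom C (Dom C \<pi>) (oC C P)"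
    using D(3,4,6,7,8) by (simp_all add: in_hom)
  show "fst P \<cdot> \<pi> = fst P \<cdot> (snd P \<cdot> r)"
    using D(9) comp_assoc[OF r PO] by simp
  show "s \<in> hom C (oC C P) (Dom C \<pi>)" "\<pi> \<cdot> s = snd P" "r \<cdot> s = Id C (oC C P)"
    using sec by (simp_all add: section_data_def)
qed

text \<open>Generalized elements of the vertex are pairs \<open>(a, c)\<close> with
  \<open>f a = f g c\<close>; the arguments below construct arrows into it in these terms.\<close>

lemma section_data_lift:
  assumes a: "a \<in> hom C X (oA C P)" and c: "c \<in> hom C X (oC C P)"
    and eq: "fst P \<cdot> a = fst P \<cdot> (snd P \<cdot> c)"
  obtains h where "h \<in> hom C X (Dom C \<pi>)" "\<pi> \<cdot> h = a" "r \<cdot> h = c"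
proof -
  note PO = pair_objD[OF P]
  have "c \<in> hom C X (Dom C (fst P \<cdot> snd P))" "fst P \<cdot> a = fst P \<cdot> snd P \<cdot> c"
    using c comp_hom[OF PO] eq comp_assoc[OF c PO] by (simp_all add: in_hom)
  then show thesis
    using pullback_lift[of "fst P" "fst P \<cdot> snd P" \<pi> r a X c] a sec that
    unfolding section_data_def by blast
qed

lemma section_data_unique:
  assumes "h \<in> hom C X (Dom C \<pi>)" "k \<in> hom C X (Dom C \<pi>)" "\<pi> \<cdot> h = \<pi> \<cdot> k" "r \<cdot> h = r \<cdot> k"
  shows "h = k"
  using pullback_unique[OF _ assms] sec unfolding section_data_def by blast

lemma section_point_obj:
  "(r, s) \<in> Obj (composable_pairs C)" "is_point C r s"
  "oA C (r, s) = Dom C \<pi>" "oB C (r, s) = oC C P" "oC C (r, s) = oC C P"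
  using section_dataD by (simp_all add: pair_obj in_hom is_point_iff)

end

text \<open>On elements this is (a, c) \<mapsto> (\<alpha> a, \<gamma> c), which is well defined
  since f' \<alpha> a = \<beta> f a = \<beta> f g c = f' \<alpha> g c = f' g' \<gamma> c.\<close>

lemma section_arrow_exists:
  assumes t: "t \<in> hom (composable_pairs C) P Q"
    and P: "section_data P \<pi> r s" and Q: "section_data Q \<pi>' r' s'"
  shows "\<exists>w. w \<in> hom C (Dom C \<pi>) (Dom C \<pi>') \<and> \<pi>' \<cdot> w = cA t \<cdot> \<pi> \<and> r' \<cdot> w = cC t \<cdot> r"
proof -
  note T = pair_homD[OF t]
  note PO = pair_objD[OF T(1)] and QO = pair_objD[OF T(2)]
  note DP = section_dataD[OF T(1) P]
  note gr = comp_hom[OF DP(2) PO(1)]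
  have "fst Q \<cdot> (cA t \<cdot> \<pi>) = cB t \<cdot> (fst P \<cdot> \<pi>)"
    by (rule comp_square[OF T(8) DP(1) T(4) QO(2) PO(2) T(5)])
  also have "\<dots> = fst Q \<cdot> (cA t \<cdot> (snd P \<cdot> r))"
    unfolding DP(6) by (rule comp_square[OF T(8)[symmetric] gr PO(2) T(5) T(4) QO(2)])
  also have "cA t \<cdot> (snd P \<cdot> r) = snd Q \<cdot> (cC t \<cdot> r)"
    by (rule comp_square[OF T(7) DP(2) PO(1) T(4) T(6) QO(1)])
  finally have "fst Q \<cdot> (cA t \<cdot> \<pi>) = fst Q \<cdot> (snd Q \<cdot> (cC t \<cdot> r))" .
  then show ?thesis
    using section_data_lift[OF T(2) Q comp_hom[OF DP(1) T(4)] comp_hom[OF DP(2) T(6)]] by blast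
qed

text \<open>The section point of \<open>P\<close> lives over the \<open>C\<close> object of
  \<open>P\<close>, so \<open>cC t\<close> appears as both of the last two components.\<close>

lemma section_arrow_hom:
  assumes t: "t \<in> hom (composable_pairs C) P Q"
    and P: "section_data P \<pi> r s" and Q: "section_data Q \<pi>' r' s'"
    and w: "w \<in> hom C (Dom C \<pi>) (Dom C \<pi>')" "\<pi>' \<cdot> w = cA t \<cdot> \<pi>" "r' \<cdot> w = cC t \<cdot> r"
  shows "((r, s), (w, cC t, cC t), (r', s')) \<in> hom (composable_pairs C) (r, s) (r', s')"
proof -
  note T = pair_homD[OF t]
  note PO = pair_objD[OF T(1)] and QO = pair_objD[OF T(2)]
  note DP = section_dataD[OF T(1) P] and DQ = section_dataD[OF T(2) Q]
  note OP = section_point_obj[OF T(1) P] and OQ = section_point_obj[OF T(2) Q]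
  have "w \<cdot> s = s' \<cdot> cC t"
  proof (rule section_data_unique[OF T(2) Q comp_hom[OF DP(3) w(1)] comp_hom[OF T(6) DQ(3)]])
    have "\<pi>' \<cdot> (w \<cdot> s) = cA t \<cdot> (\<pi> \<cdot> s)"
      by (rule comp_square[OF w(2) DP(3) w(1) DQ(1) DP(1) T(4)])
    then show "\<pi>' \<cdot> (w \<cdot> s) = \<pi>' \<cdot> (s' \<cdot> cC t)"
      using DP(4) DQ(4) T(7) comp_assoc[OF T(6) DQ(3,1)] by simp
    have "r' \<cdot> (w \<cdot> s) = cC t \<cdot> (r \<cdot> s)"
      by (rule comp_square[OF w(3) DP(3) w(1) DQ(2) DP(2) T(6)])
    then show "r' \<cdot> (w \<cdot> s) = r' \<cdot> (s' \<cdot> cC t)"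
      using DP(5) DQ(5) id_left[OF T(6)] id_right[OF T(6)] comp_assoc[OF T(6) DQ(3,2)] by simp
  qed
  then show ?thesis
    using OP OQ w T(6) by (intro pair_homI) simp_all
qed

text \<open>Limits commute with limits: an arrow into the limit of the vertices is a compatible
  family of pairs \<open>(a i, c i)\<close>, which amounts to one pair \<open>(a, c)\<close> for
  \<open>L\<close>.\<close>

lemma section_componentwise_limit:
  assumes J: "category J" and F: "is_functor J (composable_pairs C) D d"
    and L: "componentwise_limit J C D d L p"
    and sec: "\<And>i. i \<in> Obj J \<Longrightarrow> section_data (D i) (\<pi> i) (r i) (s i)"
    and secL: "section_data L \<pi>' r' s'"
  obtains d' q where "is_functor J (composable_pairs C) (\<lambda>i. (r i, s i)) d'"
    "componentwise_limit J C (\<lambda>i. (r i, s i)) d' (r', s') q"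
proof -
  let ?K = "composable_pairs C" and ?D = "\<lambda>i. (r i, s i)"
  interpret K: category ?K by (rule category_composable_pairs)
  note dJ = category.dom_obj[OF J] and cJ = category.cod_obj[OF J]
  have LA: "is_limit J C (\<lambda>i. oA C (D i)) (\<lambda>u. cA (d u)) (oA C L) (\<lambda>i. cA (p i))"
    and LB: "is_limit J C (\<lambda>i. oB C (D i)) (\<lambda>u. cB (d u)) (oB C L) (\<lambda>i. cB (p i))"
    and LC: "is_limit J C (\<lambda>i. oC C (D i)) (\<lambda>u. cC (d u)) (oC C L) (\<lambda>i. cC (p i))"
    and cone: "is_cone J ?K D d L p"
    using L unfolding componentwise_limit_iff by blast+
  note FC = pair_functor_components[OF F] and CC = pair_cone_components[OF cone]
  note Dobj = K.functorD(1)[OF F] and dh = K.functorD(2)[OF F] and ph = K.coneD(2)[OF cone]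
  note Lobj = K.coneD(1)[OF cone]
  note T = pair_homD[OF dh] and PT = pair_homD[OF ph]
  note SD = section_dataD[OF Dobj sec] and SL = section_dataD[OF Lobj secL]
  note OD = section_point_obj[OF Dobj sec] and OL = section_point_obj[OF Lobj secL]
  have "\<forall>u \<in> Arr J. \<exists>w. w \<in> hom C (Dom C (\<pi> (Dom J u))) (Dom C (\<pi> (Cod J u))) \<and>
      \<pi> (Cod J u) \<cdot> w = cA (d u) \<cdot> \<pi> (Dom J u) \<and> r (Cod J u) \<cdot> w = cC (d u) \<cdot> r (Dom J u)"
    using section_arrow_exists[OF dh sec[OF dJ] sec[OF cJ]] by blast
  \<comment> \<open>No coherence is asked of the choice: \<pi> and \<open>r\<close> are jointly
    monic, so each \<open>w u\<close> is the only arrow of its kind, and functoriality follows from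
    this.\<close>
  from bchoice[OF this] obtain w where w: "\<And>u. u \<in> Arr J \<Longrightarrow> w u \<in> hom C (Dom C (\<pi> (Dom J u))) (Dom C (\<pi> (Cod J u)))"
    "\<And>u. u \<in> Arr J \<Longrightarrow> \<pi> (Cod J u) \<cdot> w u = cA (d u) \<cdot> \<pi> (Dom J u)"
    "\<And>u. u \<in> Arr J \<Longrightarrow> r (Cod J u) \<cdot> w u = cC (d u) \<cdot> r (Dom J u)"
    by blast
  have "\<forall>i \<in> Obj J. \<exists>v. v \<in> hom C (Dom C \<pi>') (Dom C (\<pi> i)) \<and>
      \<pi> i \<cdot> v = cA (p i) \<cdot> \<pi>' \<and> r i \<cdot> v = cC (p i) \<cdot> r'"
    using section_arrow_exists[OF ph secL sec] by blast
  from bchoice[OF this] obtain v where v: "\<And>i. i \<in> Obj J \<Longrightarrow> v i \<in> hom C (Dom C \<pi>') (Dom C (\<pi> i))"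
    "\<And>i. i \<in> Obj J \<Longrightarrow> \<pi> i \<cdot> v i = cA (p i) \<cdot> \<pi>'" "\<And>i. i \<in> Obj J \<Longrightarrow> r i \<cdot> v i = cC (p i) \<cdot> r'"
    by blast
  define d' where "d' u = (?D (Dom J u), (w u, cC (d u), cC (d u)), ?D (Cod J u))" for u
  define q where "q i = ((r', s'), (v i, cC (p i), cC (p i)), ?D i)" for i
  have d'_hom: "d' u \<in> hom ?K (?D (Dom J u)) (?D (Cod J u))" if u: "u \<in> Arr J" for u
    unfolding d'_def by (rule section_arrow_hom[OF dh[OF u] sec[OF dJ[OF u]] sec[OF cJ[OF u]] w[OF u]])
  have q_hom: "q i \<in> hom ?K (r', s') (?D i)" if i: "i \<in> Obj J" for i
    unfolding q_def by (rule section_arrow_hom[OF ph[OF i] secL sec[OF i] v[OF i]])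
  have comps [simp]: "cA (d' u) = w u" "cB (d' u) = cC (d u)" "cC (d' u) = cC (d u)"
    "cA (q i) = v i" "cB (q i) = cC (p i)" "cC (q i) = cC (p i)" for u i
    by (simp_all add: d'_def q_def)
  have F': "is_functor J ?K ?D d'"
    unfolding is_functor_def
  proof (intro conjI ballI impI)
    show "?D i \<in> Obj ?K" if "i \<in> Obj J" for i by (rule OD(1)[OF that that])
    show "d' u \<in> hom ?K (?D (Dom J u)) (?D (Cod J u))" if "u \<in> Arr J" for u by (rule d'_hom[OF that])
    show "d' (Id J i) = Id ?K (?D i)" if i: "i \<in> Obj J" for i
    proof -
      have id: "Id J i \<in> Arr J" "Dom J (Id J i) = i" "Cod J (Id J i) = i"
        using category.id_hom[OF J i] by (simp_all add: in_hom)
      have dI: "cA (d (Id J i)) = Id C (oA C (D i))" "cC (d (Id J i)) = Id C (oC C (D i))"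
        using K.functorD(3)[OF F i] by simp_all
      note W = w[OF id(1), unfolded id(2,3) dI]
      have "w (Id J i) = Id C (Dom C (\<pi> i))"
        by (rule section_data_unique[OF Dobj[OF i] sec[OF i] W(1) id_hom[OF hom_obj(2)[OF W(1)]]])
          (use W(2,3) id_left[OF SD(1)[OF i i]] id_left[OF SD(2)[OF i i]] id_right[OF SD(1)[OF i i]]
            id_right[OF SD(2)[OF i i]] in simp_all)
      then show ?thesis
        using d'_hom[OF id(1)] K.id_hom[OF OD(1)[OF i i]] dI OD(3-5)[OF i i]
        unfolding id(2,3) by (intro pair_eqI) simp_all
    qed
    fix u u' assume u: "u \<in> Arr J" and u': "u' \<in> Arr J" and comp: "Dom J u' = Cod J u"
    have uu: "u' \<cdot>\<^bsub>J\<^esub> u \<in> Arr J" "Dom J (u' \<cdot>\<^bsub>J\<^esub> u) = Dom J u" "Cod J (u' \<cdot>\<^bsub>J\<^esub> u) = Cod J u'"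
      using category.comp_arr[OF J u' u] comp by simp_all
    have dd: "cA (d (u' \<cdot>\<^bsub>J\<^esub> u)) = cA (d u') \<cdot> cA (d u)" "cC (d (u' \<cdot>\<^bsub>J\<^esub> u)) = cC (d u') \<cdot> cC (d u)"
      using K.functorD(4)[OF F u u' comp] by simp_all
    note W = w[OF uu(1), unfolded uu(2,3) dd] and Wu = w[OF u] and Wu' = w[OF u', unfolded comp]
    note i = dJ[OF u] and j = cJ[OF u] and k = cJ[OF u']
    have eq: "w (u' \<cdot>\<^bsub>J\<^esub> u) = w u' \<cdot> w u"
    proof (rule section_data_unique[OF Dobj[OF k] sec[OF k] W(1) comp_hom[OF Wu(1) Wu'(1)]])
      have "\<pi> (Cod J u') \<cdot> (w u' \<cdot> w u) = cA (d u') \<cdot> (\<pi> (Cod J u) \<cdot> w u)"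
        by (rule comp_square[OF Wu'(2) Wu(1) Wu'(1) SD(1)[OF k k] SD(1)[OF j j] T(4)[OF u', unfolded comp]])
      also have "\<dots> = cA (d u') \<cdot> cA (d u) \<cdot> \<pi> (Dom J u)"
        using Wu(2) comp_assoc[OF SD(1)[OF i i] T(4)[OF u] T(4)[OF u', unfolded comp]] by simp
      finally show "\<pi> (Cod J u') \<cdot> w (u' \<cdot>\<^bsub>J\<^esub> u) = \<pi> (Cod J u') \<cdot> (w u' \<cdot> w u)"
        using W(2) by simp
      have "r (Cod J u') \<cdot> (w u' \<cdot> w u) = cC (d u') \<cdot> (r (Cod J u) \<cdot> w u)"
        by (rule comp_square[OF Wu'(3) Wu(1) Wu'(1) SD(2)[OF k k] SD(2)[OF j j] T(6)[OF u', unfolded comp]])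
      also have "\<dots> = cC (d u') \<cdot> cC (d u) \<cdot> r (Dom J u)"
        using Wu(3) comp_assoc[OF SD(2)[OF i i] T(6)[OF u] T(6)[OF u', unfolded comp]] by simp
      finally show "r (Cod J u') \<cdot> w (u' \<cdot>\<^bsub>J\<^esub> u) = r (Cod J u') \<cdot> (w u' \<cdot> w u)"
        using W(3) by simp
    qed
    show "d' (u' \<cdot>\<^bsub>J\<^esub> u) = d' u' \<cdot>\<^bsub>?K\<^esub> d' u"
      by (rule pair_eqI[OF d'_hom[OF uu(1), unfolded uu(2,3)]
            K.comp_hom[OF d'_hom[OF u] d'_hom[OF u', unfolded comp]]])
        (simp_all add: eq dd)
  qed
  have vw: "w u \<cdot> v (Dom J u) = v (Cod J u)" if u: "u \<in> Arr J" for u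
  proof -
    note i = dJ[OF u] and j = cJ[OF u]
    show ?thesis
    proof (rule section_data_unique[OF Dobj[OF j] sec[OF j] comp_hom[OF v(1)[OF i] w(1)[OF u]] v(1)[OF j]])
      have "\<pi> (Cod J u) \<cdot> (w u \<cdot> v (Dom J u)) = cA (d u) \<cdot> (\<pi> (Dom J u) \<cdot> v (Dom J u))"
        by (rule comp_square[OF w(2)[OF u] v(1)[OF i] w(1)[OF u] SD(1)[OF j j] SD(1)[OF i i] T(4)[OF u]])
      also have "\<dots> = \<pi> (Cod J u) \<cdot> v (Cod J u)"
        using v(2)[OF i] v(2)[OF j] comp_assoc[OF SL(1) PT(4)[OF i] T(4)[OF u]] coneD(3)[OF CC(1) u] by simp
      finally show "\<pi> (Cod J u) \<cdot> (w u \<cdot> v (Dom J u)) = \<pi> (Cod J u) \<cdot> v (Cod J u)" .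
      have "r (Cod J u) \<cdot> (w u \<cdot> v (Dom J u)) = cC (d u) \<cdot> (r (Dom J u) \<cdot> v (Dom J u))"
        by (rule comp_square[OF w(3)[OF u] v(1)[OF i] w(1)[OF u] SD(2)[OF j j] SD(2)[OF i i] T(6)[OF u]])
      also have "\<dots> = r (Cod J u) \<cdot> v (Cod J u)"
        using v(3)[OF i] v(3)[OF j] comp_assoc[OF SL(2) PT(6)[OF i] T(6)[OF u]] coneD(3)[OF CC(3) u] by simp
      finally show "r (Cod J u) \<cdot> (w u \<cdot> v (Dom J u)) = r (Cod J u) \<cdot> v (Cod J u)" .
    qed
  qed
  have cone': "is_cone J ?K ?D d' (r', s') q"
    unfolding is_cone_def
  proof (intro conjI ballI)
    fix u assume u: "u \<in> Arr J"
    show "d' u \<cdot>\<^bsub>?K\<^esub> q (Dom J u) = q (Cod J u)"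
      by (rule pair_eqI[OF K.comp_hom[OF q_hom[OF dJ[OF u]] d'_hom[OF u]] q_hom[OF cJ[OF u]]])
        (simp_all add: vw[OF u] coneD(3)[OF CC(3) u])
  qed (use OL(1) q_hom in blast)+
  have limA: "is_limit J C (\<lambda>i. oA C (?D i)) (\<lambda>u. cA (d' u)) (oA C (r', s')) (\<lambda>i. cA (q i))"
  proof (rule limitI)
    show "is_cone J C (\<lambda>i. oA C (?D i)) (\<lambda>u. cA (d' u)) (oA C (r', s')) (\<lambda>i. cA (q i))"
      by (rule pair_cone_components(1)[OF cone'])
    fix X
    {
      fix x assume "is_cone J C (\<lambda>i. oA C (?D i)) (\<lambda>u. cA (d' u)) X x"
      note x = coneD[OF this, unfolded comps]
      have xh: "x i \<in> hom C X (Dom C (\<pi> i))" if "i \<in> Obj J" for i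
        using x(2)[OF that] OD(3)[OF that that] by simp
      have "is_cone J C (\<lambda>i. oA C (D i)) (\<lambda>u. cA (d u)) X (\<lambda>i. \<pi> i \<cdot> x i)"
        unfolding is_cone_def
      proof (intro conjI ballI x(1))
        show "\<pi> i \<cdot> x i \<in> hom C X (oA C (D i))" if "i \<in> Obj J" for i
          by (rule comp_hom[OF xh[OF that] SD(1)[OF that that]])
        fix u assume u: "u \<in> Arr J"
        note i = dJ[OF u] and j = cJ[OF u]
        show "cA (d u) \<cdot> (\<pi> (Dom J u) \<cdot> x (Dom J u)) = \<pi> (Cod J u) \<cdot> x (Cod J u)"
          unfolding x(3)[OF u, symmetric]
          by (rule comp_square[OF w(2)[OF u, symmetric] xh[OF i] SD(1)[OF i i] T(4)[OF u] w(1)[OF u] SD(1)[OF j j]])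
      qed
      then obtain a where a: "a \<in> hom C X (oA C L)" "\<And>i. i \<in> Obj J \<Longrightarrow> cA (p i) \<cdot> a = \<pi> i \<cdot> x i"
        using limit_lift[OF LA] by blast
      have "is_cone J C (\<lambda>i. oC C (D i)) (\<lambda>u. cC (d u)) X (\<lambda>i. r i \<cdot> x i)"
        unfolding is_cone_def
      proof (intro conjI ballI x(1))
        show "r i \<cdot> x i \<in> hom C X (oC C (D i))" if "i \<in> Obj J" for i
          by (rule comp_hom[OF xh[OF that] SD(2)[OF that that]])
        fix u assume u: "u \<in> Arr J"
        note i = dJ[OF u] and j = cJ[OF u]
        show "cC (d u) \<cdot> (r (Dom J u) \<cdot> x (Dom J u)) = r (Cod J u) \<cdot> x (Cod J u)"
          unfolding x(3)[OF u, symmetric]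
          by (rule comp_square[OF w(3)[OF u, symmetric] xh[OF i] SD(2)[OF i i] T(6)[OF u] w(1)[OF u] SD(2)[OF j j]])
      qed
      then obtain c where c: "c \<in> hom C X (oC C L)" "\<And>i. i \<in> Obj J \<Longrightarrow> cC (p i) \<cdot> c = r i \<cdot> x i"
        using limit_lift[OF LC] by blast
      note LO = pair_objD[OF Lobj]
      note gc = comp_hom[OF c(1) LO(1)]
      \<comment> \<open>The component over \<open>B\<close> enters here: its legs separate the two
        sides, and at each \<open>D i\<close> the equation holds because \<open>x i\<close> lands in
        the vertex there.\<close>
      have "fst L \<cdot> a = fst L \<cdot> (snd L \<cdot> c)"
      proof (rule limit_unique[OF J FC(2) LB comp_hom[OF a(1) LO(2)] comp_hom[OF gc LO(2)]])
        fix i assume i: "i \<in> Obj J"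
        note DO = pair_objD[OF Dobj[OF i]]
        have "cB (p i) \<cdot> (fst L \<cdot> a) = fst (D i) \<cdot> (cA (p i) \<cdot> a)"
          by (rule comp_square[OF PT(8)[OF i, symmetric] a(1) LO(2) PT(5)[OF i] PT(4)[OF i] DO(2)])
        also have "\<dots> = fst (D i) \<cdot> (snd (D i) \<cdot> r i \<cdot> x i)"
          unfolding a(2)[OF i]
          by (rule comp_square[OF SD(6)[OF i i] xh[OF i] SD(1)[OF i i] DO(2)
                comp_hom[OF SD(2)[OF i i] DO(1)] DO(2)])
        also have "snd (D i) \<cdot> r i \<cdot> x i = snd (D i) \<cdot> (cC (p i) \<cdot> c)"
          using comp_assoc[OF xh[OF i] SD(2)[OF i i] DO(1)] c(2)[OF i] by simp
        also have "\<dots> = cA (p i) \<cdot> (snd L \<cdot> c)"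
          by (rule comp_square[OF PT(7)[OF i, symmetric] c(1) PT(6)[OF i] DO(1) LO(1) PT(4)[OF i]])
        also have "fst (D i) \<cdot> \<dots> = cB (p i) \<cdot> (fst L \<cdot> (snd L \<cdot> c))"
          by (rule comp_square[OF PT(8)[OF i] gc PT(4)[OF i] DO(2) LO(2) PT(5)[OF i]])
        finally show "cB (p i) \<cdot> (fst L \<cdot> a) = cB (p i) \<cdot> (fst L \<cdot> (snd L \<cdot> c))" .
      qed
      then obtain h where h: "h \<in> hom C X (Dom C \<pi>')" "\<pi>' \<cdot> h = a" "r' \<cdot> h = c"
        using section_data_lift[OF Lobj secL a(1) c(1)] by blast
      have "v i \<cdot> h = x i" if i: "i \<in> Obj J" for i
      proof (rule section_data_unique[OF Dobj[OF i] sec[OF i] comp_hom[OF h(1) v(1)[OF i]] xh[OF i]])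
        have "\<pi> i \<cdot> (v i \<cdot> h) = cA (p i) \<cdot> (\<pi>' \<cdot> h)"
          by (rule comp_square[OF v(2)[OF i] h(1) v(1)[OF i] SD(1)[OF i i] SL(1) PT(4)[OF i]])
        then show "\<pi> i \<cdot> (v i \<cdot> h) = \<pi> i \<cdot> x i"
          using h(2) a(2)[OF i] by simp
        have "r i \<cdot> (v i \<cdot> h) = cC (p i) \<cdot> (r' \<cdot> h)"
          by (rule comp_square[OF v(3)[OF i] h(1) v(1)[OF i] SD(2)[OF i i] SL(2) PT(6)[OF i]])
        then show "r i \<cdot> (v i \<cdot> h) = r i \<cdot> x i"
          using h(3) c(2)[OF i] by simp
      qed
      then show "\<exists>h \<in> hom C X (oA C (r', s')). \<forall>i \<in> Obj J. cA (q i) \<cdot> h = x i"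
        using h(1) OL(3) by auto
    next
      fix h k assume "h \<in> hom C X (oA C (r', s'))" "k \<in> hom C X (oA C (r', s'))"
        and "\<And>i. i \<in> Obj J \<Longrightarrow> cA (q i) \<cdot> h = cA (q i) \<cdot> k"
      then have h: "h \<in> hom C X (Dom C \<pi>')" and k: "k \<in> hom C X (Dom C \<pi>')"
        and eq: "\<And>i. i \<in> Obj J \<Longrightarrow> v i \<cdot> h = v i \<cdot> k"
        unfolding OL(3) comps by auto
      have vA: "\<pi> i \<cdot> (v i \<cdot> x) = cA (p i) \<cdot> (\<pi>' \<cdot> x)"
        and vC: "r i \<cdot> (v i \<cdot> x) = cC (p i) \<cdot> (r' \<cdot> x)"
        if i: "i \<in> Obj J" and x: "x \<in> hom C X (Dom C \<pi>')" for i x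
        by (rule comp_square[OF v(2)[OF i] x v(1)[OF i] SD(1)[OF i i] SL(1) PT(4)[OF i]],
          rule comp_square[OF v(3)[OF i] x v(1)[OF i] SD(2)[OF i i] SL(2) PT(6)[OF i]])
      show "h = k"
      proof (rule section_data_unique[OF Lobj secL h k])
        show "\<pi>' \<cdot> h = \<pi>' \<cdot> k"
          by (rule limit_unique[OF J FC(1) LA comp_hom[OF h SL(1)] comp_hom[OF k SL(1)]])
            (use vA[OF _ h] vA[OF _ k] eq in simp)
        show "r' \<cdot> h = r' \<cdot> k"
          by (rule limit_unique[OF J FC(3) LC comp_hom[OF h SL(2)] comp_hom[OF k SL(2)]])
            (use vC[OF _ h] vC[OF _ k] eq in simp)
      qed
    }
  qed
  \<comment> \<open>The codomain of \<open>r i\<close> and the domain of \<open>s i\<close> are both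
    the \<open>C\<close> object of \<open>D i\<close>, so both remaining components are the limit
    \<open>LC\<close>.\<close>
  have "is_limit J C (\<lambda>i. oB C (?D i)) (\<lambda>u. cB (d' u)) (oB C (r', s')) (\<lambda>i. cB (q i))"
    "is_limit J C (\<lambda>i. oC C (?D i)) (\<lambda>u. cC (d' u)) (oC C (r', s')) (\<lambda>i. cC (q i))"
    using LC limit_cong[OF J, of "\<lambda>i. oB C (?D i)" "\<lambda>i. oC C (D i)" "\<lambda>u. cC (d u)" "\<lambda>u. cC (d u)"
        "\<lambda>i. cC (p i)" "\<lambda>i. cC (p i)" C "oC C L"]
      limit_cong[OF J, of "\<lambda>i. oC C (?D i)" "\<lambda>i. oC C (D i)" "\<lambda>u. cC (d u)" "\<lambda>u. cC (d u)"
        "\<lambda>i. cC (p i)" "\<lambda>i. cC (p i)" C "oC C L"] OD(4,5)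
    unfolding OL(4,5) comps by blast+
  with cone' limA have "componentwise_limit J C ?D d' (r', s') q"
    unfolding componentwise_limit_iff by blast
  with F' show thesis
    by (rule that)
qed

section \<open>The correspondence\<close>

text \<open>By \<open>section_point_unique\<close>, the existential in \<open>G_map\<close> can be
  tested on any one section point.\<close>

lemma G_map_iff:
  assumes S: "pt_pullback_stable C S"
    and gp: "is_gen_point C f g" and sec: "is_section_point C f g p h"
  shows "(f, g) \<in> G_map C S \<longleftrightarrow> (p, h) \<in> S"
proof -
  note fg = gen_pointD[OF gp]
  have "(p, h) \<in> S" if "is_section_point C f g p' h'" "(p', h') \<in> S" for p' h'
    using section_point_unique[OF S fg(1-3) that(1) sec that(2)] .
  then show ?thesis
    using gp sec unfolding G_map_def by blast
qed

lemma F_map_G_map: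
  assumes S: "pt_pullback_stable C S" and sub: "S \<subseteq> Obj (Pt C)"
  shows "F_map C (G_map C S) = S"
proof -
  have "(f, s) \<in> F_map C (G_map C S) \<longleftrightarrow> (f, s) \<in> S" for f s
  proof (cases "is_point C f s")
    case True
    then have "is_gen_point C f s" by (simp add: is_point_def)
    then show ?thesis
      using G_map_iff[OF S _ point_section_point[OF True]] True by (simp add: F_map_def)
  next
    case False
    then show ?thesis
      using sub by (auto simp: F_map_def Obj_Pt)
  qed
  then show ?thesis by auto
qed

lemma G_map_F_map:
  assumes lim: "has_finite_limits C" and T: "T_protomodular C T"
  shows "G_map C (F_map C T) = T"
proof -
  have sub: "T \<subseteq> Obj (GPt C)"
    and d: "\<And>f g p h. \<lbrakk>is_gen_point C f g; is_section_point C f g p h\<rbrakk> \<Longrightarrow> (p, h) \<in> T \<longleftrightarrow> (f, g) \<in> T"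
    using T unfolding T_protomodular_def by blast+
  have "(f, g) \<in> G_map C (F_map C T) \<longleftrightarrow> (f, g) \<in> T" for f g
  proof (cases "is_gen_point C f g")
    case True
    note fg = gen_pointD[OF True]
    obtain p h where "is_section_point C f g p h"
      using section_point_exists[OF lim fg(1-3)] .
    then show ?thesis
      using d[OF True] True section_point_is_point[OF _ fg(1-3)] unfolding G_map_def F_map_def by blast
  next
    case False
    then show ?thesis
      using sub by (auto simp: G_map_def Obj_GPt)
  qed
  then show ?thesis by auto
qed

section \<open>Transfer of protomodularity along the two maps\<close>

lemma functor_GPt_iff:
  "is_functor J (GPt C) D d \<longleftrightarrow>
    is_functor J (composable_pairs C) D d \<and> (\<forall>i \<in> Obj J. D i \<in> {(f, g). is_gen_point C f g})"
  if "category J"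
  unfolding GPt_def by (rule functor_full_subcategory[OF that])

lemma functor_Pt_iff:
  "is_functor J (Pt C) D d \<longleftrightarrow>
    is_functor J (composable_pairs C) D d \<and> (\<forall>i \<in> Obj J. D i \<in> {(f, g). is_point C f g})"
  if "category J"
  unfolding Pt_eq by (rule functor_full_subcategory[OF that])

lemma S_protomodular_F_map:
  assumes lim: "has_finite_limits C" and T: "T_protomodular C T"
  shows "S_protomodular C (F_map C T)"
  unfolding S_protomodular_def
proof (intro conjI)
  have pb: "gpt_pullback_stable C T" and cl: "closed_under_componentwise_finite_limits C T"
    and str: "\<forall>(f, g) \<in> T. strong_gen_point C f g"
    using T unfolding T_protomodular_def by blast+
  show "F_map C T \<subseteq> Obj (Pt C)"
    by (auto simp: F_map_def Obj_Pt)
  show "\<forall>(f, s) \<in> F_map C T. strong_gen_point C f s"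
    using str by (auto simp: F_map_def)
  show "pt_pullback_stable C (F_map C T)"
    unfolding pt_pullback_stable_def
  proof (intro allI impI, elim conjE)
    fix f s x p1 p2 h
    assume fs: "(f, s) \<in> F_map C T" and P: "is_pullback C f x p1 p2"
      and h: "h \<in> hom C (Dom C x) (Dom C p1)" "p1 \<cdot> h = s \<cdot> x" "p2 \<cdot> h = Id C (Dom C x)"
    note D = pullbackD[OF P]
    have pt: "is_point C f s" "(f, s) \<in> T"
      using fs by (auto simp: F_map_def)
    \<comment> \<open>As \<open>f \<cdot> s\<close> is an identity, its pullback along
      \<open>x\<close> may be taken with projections \<open>x\<close> and the identity. For this
      choice, stability of generalized points yields the pullback of a point.\<close>
    have "f \<cdot> s = Id C (Cod C x)"
      using pt(1) D(5) by (simp add: is_point_iff)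
    then have "is_pullback C (f \<cdot> s) x x (Id C (Dom C x))"
      using pullback_sym[OF pullback_id[OF D(2)]] by simp
    then have "(p2, h) \<in> T"
      using pb pt(2) P h unfolding gpt_pullback_stable_def by blast
    moreover have "is_point C p2 h"
      using D h by (simp add: is_point_iff in_hom)
    ultimately show "(p2, h) \<in> F_map C T"
      by (simp add: F_map_def)
  qed
  show "closed_under_finite_limits_in_Pt C (F_map C T)"
    unfolding closed_under_finite_limits_in_Pt_def
  proof (intro allI impI, elim conjE)
    fix J D d L p
    assume J: "finite_category J" and F: "is_functor J (Pt C) D d"
      and DT: "\<forall>i \<in> Obj J. D i \<in> F_map C T" and L: "is_limit J (Pt C) D d L p"
    have Jc: "category J"
      using J by (simp add: finite_category_def)
    have "is_functor J (GPt C) D d"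
      using F unfolding functor_GPt_iff[OF Jc] functor_Pt_iff[OF Jc] by (auto simp: is_point_def)
    moreover have LP: "L \<in> Obj (Pt C)"
      using L by (simp add: is_limit_def is_cone_def)
    then have "L \<in> Obj (GPt C)"
      by (auto simp: Obj_Pt Obj_GPt is_point_def)
    moreover have "\<forall>i \<in> Obj J. D i \<in> T"
      using DT by (auto simp: F_map_def)
    ultimately have "L \<in> T"
      using cl J Pt_limit_componentwise[OF lim J F L]
      unfolding closed_under_componentwise_finite_limits_def by blast
    with LP show "L \<in> F_map C T"
      by (auto simp: F_map_def Obj_Pt)
  qed
qed

lemma T_protomodular_G_map:
  assumes pt: "pointed C" and lim: "has_finite_limits C" and S: "S_protomodular C S"
  shows "T_protomodular C (G_map C S)"
  unfolding T_protomodular_def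
proof (intro conjI)
  have sub: "S \<subseteq> Obj (Pt C)" and pb: "pt_pullback_stable C S"
    and cl: "closed_under_finite_limits_in_Pt C S" and str: "\<forall>(f, s) \<in> S. strong_gen_point C f s"
    using S unfolding S_protomodular_def by blast+
  show "G_map C S \<subseteq> Obj (GPt C)"
    by (auto simp: G_map_def Obj_GPt)
  show "\<forall>(f, g) \<in> G_map C S. strong_gen_point C f g"
    using strong_of_section_point[OF pt lim] str unfolding G_map_def by blast
  show "gpt_pullback_stable C (G_map C S)"
    unfolding gpt_pullback_stable_def
  proof (intro allI impI, elim conjE)
    fix f g x p1 p2 c1 c2 h
    assume fg: "(f, g) \<in> G_map C S" and P: "is_pullback C f x p1 p2"
      and Q: "is_pullback C (f \<cdot> g) x c1 c2"
      and h: "h \<in> hom C (Dom C c1) (Dom C p1)" "p1 \<cdot> h = g \<cdot> c1" "p2 \<cdot> h = c2"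
    obtain p s where gp: "is_gen_point C f g" and ps: "is_section_point C f g p s" "(p, s) \<in> S"
      using fg by (auto simp: G_map_def)
    have gp': "is_gen_point C p2 h"
      by (rule gen_point_pullback[OF gp P Q h(1,3)])
    obtain p' s' where ps': "is_section_point C p2 h p' s'"
      using section_point_exists[OF lim gen_pointD(1-3)[OF gp']] .
    have "(p', s') \<in> S"
      by (rule section_point_pullback[OF pb gen_pointD(1-3)[OF gp] P Q h ps(1) ps' ps(2)])
    with gp' ps' show "(p2, h) \<in> G_map C S"
      by (auto simp: G_map_def)
  qed
  show "\<forall>f g p h. is_gen_point C f g \<and> is_section_point C f g p h \<longrightarrow>
      ((p, h) \<in> G_map C S \<longleftrightarrow> (f, g) \<in> G_map C S)"
  proof (intro allI impI, elim conjE)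
    fix f g p h assume gp: "is_gen_point C f g" and sec: "is_section_point C f g p h"
    have p: "is_point C p h"
      by (rule section_point_is_point[OF sec gen_pointD(1-3)[OF gp]])
    then have "is_gen_point C p h"
      by (simp add: is_point_def)
    \<comment> \<open>Both memberships reduce to \<open>(p, h) \<in> S\<close>, since
      \<open>(p, h)\<close> is its own section point as well as that of
      \<open>(f, g)\<close>.\<close>
    then show "(p, h) \<in> G_map C S \<longleftrightarrow> (f, g) \<in> G_map C S"
      using G_map_iff[OF pb _ point_section_point[OF p]] G_map_iff[OF pb gp sec] by simp
  qed
  show "closed_under_componentwise_finite_limits C (G_map C S)"
    unfolding closed_under_componentwise_finite_limits_def
  proof (intro allI impI, elim conjE)
    fix J D d L p
    assume J: "finite_category J" and F: "is_functor J (GPt C) D d"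
      and DG: "\<forall>i \<in> Obj J. D i \<in> G_map C S" and L: "componentwise_limit J C D d L p"
      and LO: "L \<in> Obj (GPt C)"
    have Jc: "category J"
      using J by (simp add: finite_category_def)
    have FK: "is_functor J (composable_pairs C) D d"
      using F unfolding functor_GPt_iff[OF Jc] by blast
    \<comment> \<open>Membership in \<open>G_map C S\<close> provides a section point in
      \<open>S\<close> for each object of the diagram; these are then chosen simultaneously.\<close>
    have "\<exists>\<pi> r s. section_data (D i) \<pi> r s \<and> (r, s) \<in> S" if i: "i \<in> Obj J" for i
    proof -
      obtain f g where "D i = (f, g)"
        by (cases "D i")
      moreover have "D i \<in> G_map C S"
        using DG i by blast
      ultimately show ?thesis
        unfolding G_map_def is_section_point_iff by auto
    qed
    then obtain \<pi> r s where sec: "\<And>i. i \<in> Obj J \<Longrightarrow> section_data (D i) (\<pi> i) (r i) (s i)"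
      and rs: "\<And>i. i \<in> Obj J \<Longrightarrow> (r i, s i) \<in> S"
      by metis
    obtain f g where fg: "L = (f, g)" and gp: "is_gen_point C f g"
      using LO by (auto simp: Obj_GPt)
    obtain r' s' where rs': "is_section_point C f g r' s'"
      using section_point_exists[OF lim gen_pointD(1-3)[OF gp]] .
    then obtain \<pi>' where secL: "section_data L \<pi>' r' s'"
      unfolding fg is_section_point_iff by blast
    obtain d' q where F': "is_functor J (composable_pairs C) (\<lambda>i. (r i, s i)) d'"
      and L': "componentwise_limit J C (\<lambda>i. (r i, s i)) d' (r', s') q"
      using section_componentwise_limit[OF Jc FK L sec secL] .
    have pts: "\<forall>i \<in> Obj J. (r i, s i) \<in> {(f, g). is_point C f g}"
      using rs sub unfolding Obj_Pt by blast
    have "(r', s') \<in> {(f, g). is_point C f g}"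
      using section_point_is_point[OF rs' gen_pointD(1-3)[OF gp]] by simp
    \<comment> \<open>Closure of \<open>S\<close> refers to limits in \<open>Pt C\<close>. The
      component-wise limit is one of these because its vertex is a point and the subcategory is
      full.\<close>
    then have "is_limit J (Pt C) (\<lambda>i. (r i, s i)) d' (r', s') q"
      unfolding Pt_eq
      by (intro limit_full_subcategory[OF componentwise_limit_is_limit[OF Jc F' L']] pts)
    moreover have "is_functor J (Pt C) (\<lambda>i. (r i, s i)) d'"
      using F' pts unfolding functor_Pt_iff[OF Jc] by blast
    moreover have "\<forall>i \<in> Obj J. (r i, s i) \<in> S"
      using rs by blast
    ultimately have "(r', s') \<in> S"
      using cl J unfolding closed_under_finite_limits_in_Pt_def by blast
    then show "L \<in> G_map C S"
      using rs' gp by (auto simp: fg G_map_def)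
  qed
qed

end

theorem theorem2:
  fixes C :: "('o, 'm) cat"
  assumes "category C" and "pointed C" and "has_finite_limits C"
  shows "F_map C ` gen_point_classes C \<subseteq> point_classes C \<and>
    G_map C ` point_classes C \<subseteq> gen_point_classes C \<and>
    bij_betw (F_map C)
      {T \<in> gen_point_classes C. T_protomodular C T} {S \<in> point_classes C. S_protomodular C S} \<and>
    bij_betw (G_map C)
      {S \<in> point_classes C. S_protomodular C S} {T \<in> gen_point_classes C. T_protomodular C T} \<and>
    (\<forall>T \<in> gen_point_classes C. T_protomodular C T \<longrightarrow> G_map C (F_map C T) = T) \<and>
    (\<forall>S \<in> point_classes C. S_protomodular C S \<longrightarrow> F_map C (G_map C S) = S)"
proof -
  interpret category C by fact
  note pt = \<open>pointed C\<close> and lim = \<open>has_finite_limits C\<close>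
  let ?T = "{T \<in> gen_point_classes C. T_protomodular C T}"
  let ?S = "{S \<in> point_classes C. S_protomodular C S}"
  have F: "F_map C ` gen_point_classes C \<subseteq> point_classes C"
    by (auto simp: F_map_def point_classes_def Obj_Pt)
  have G: "G_map C ` point_classes C \<subseteq> gen_point_classes C"
    by (auto simp: G_map_def gen_point_classes_def Obj_GPt)
  have GF: "\<forall>T \<in> gen_point_classes C. T_protomodular C T \<longrightarrow> G_map C (F_map C T) = T"
    using G_map_F_map[OF lim] by blast
  have FG: "\<forall>S \<in> point_classes C. S_protomodular C S \<longrightarrow> F_map C (G_map C S) = S"
    using F_map_G_map unfolding S_protomodular_def by blast
  have FS: "F_map C ` ?T \<subseteq> ?S"
    using F S_protomodular_F_map[OF lim] by blast
  have GT: "G_map C ` ?S \<subseteq> ?T"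
    using G T_protomodular_G_map[OF pt lim] by blast
  have "bij_betw (F_map C) ?T ?S" "bij_betw (G_map C) ?S ?T"
    using bij_betw_byWitness[OF _ _ FS GT] bij_betw_byWitness[OF _ _ GT FS] GF FG by blast+
  with F G GF FG show ?thesis
    by blast
qed

end
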